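(* Let $n=2$, $\mu>0$, $\beta>1$, $R\ge 1$ and $1<p<2$. Assume that $f\in H^1(\mathbb{R}^2)$ and $g\in L^2(\mathbb{R}^2)$ are both non-negative, that $f$ does not vanish identically, and that $$\int_{\mathbb{R}^2}g(x)\,dx\neq 0.$$ Then there exist a constant $\varepsilon_0=\varepsilon_0(f,g,p,\mu,\beta,R)>0$ and a positive constant $C$ independent of $\varepsilon$ such that the following holds for every $0<\varepsilon\le\varepsilon_0$: if $T>0$ and $u$ is an energy solution over $[0,T)$ of $$u_{tt}-\Delta u+\frac{\mu}{(1+t)^\beta}u_t=|u|^p,\qquad u(x,0)=\varepsilon f(x),\quad u_t(x,0)=\varepsilon g(x),\qquad x\in\mathbb{R}^2,$$ satisfying $$\operatorname{supp} u\subset\{(x,t)\in\mathbb{R}^2\times[0,T): |x|\le t+R\},$$ then $$T\le C\,\varepsilon^{-(p-1)/(3-p)}.$$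
   Context: Functions are real-valued. Energy solution (here $n=2$): $u$ is an energy solution over $[0,T)$ of the initial value problem if $$u\in C([0,T),H^1(\mathbb{R}^n))\cap C^1([0,T),L^2(\mathbb{R}^n))\cap L^p_{\rm loc}(\mathbb{R}^n\times(0,T)),$$ $u(\cdot,0)=\varepsilon f$, $u_t(\cdot,0)=\varepsilon g$, and $$\int_{\mathbb{R}^n}u_t(x,t)\phi(x,t)\,dx-\int_{\mathbb{R}^n}u_t(x,0)\phi(x,0)\,dx+\int_0^t ds\int_{\mathbb{R}^n}\left\{-u_t(x,s)\phi_t(x,s)+\nabla u(x,s)\cdot\nabla\phi(x,s)\right\}dx$$ $$+\int_0^t ds\int_{\mathbb{R}^n}\frac{\mu u_t(x,s)}{(1+s)^{\beta}}\phi(x,s)\,dx=\int_0^t ds\int_{\mathbb{R}^n}|u(x,s)|^p\phi(x,s)\,dx$$ for every $\phi\in C_0^\infty(\mathbb{R}^n\times[0,T))$ and every $t\in[0,T)$. *)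

theory Defs
  imports "HOL-Analysis.Analysis"
begin

text \<open>
  Lebesgue classes are represented by functions, with equality almost everywhere. A function \<open>u\<close>
  of \<open>(x,t)\<close> represents a curve of classes \<open>t \<mapsto> u(\<cdot>,t)\<close>, one for every single \<open>t\<close>.
\<close>

primrec Ck :: "nat \<Rightarrow> ('a::euclidean_space \<Rightarrow> real) \<Rightarrow> bool" where
  "Ck 0 \<phi> \<longleftrightarrow> continuous_on UNIV \<phi>"
| "Ck (Suc k) \<phi> \<longleftrightarrow>
     (\<forall>x. \<phi> differentiable (at x)) \<and>
     (\<forall>b\<in>Basis. Ck k (\<lambda>x. frechet_derivative \<phi> (at x) b))"

definition smooth :: "('a::euclidean_space \<Rightarrow> real) \<Rightarrow> bool" where
  "smooth \<phi> \<longleftrightarrow> (\<forall>k. Ck k \<phi>)"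

definition Cc_infinity :: "'a::euclidean_space set \<Rightarrow> ('a \<Rightarrow> real) set" where
  "Cc_infinity S =
     {\<phi>. smooth \<phi> \<and> compact (closure {x. \<phi> x \<noteq> 0}) \<and> closure {x. \<phi> x \<noteq> 0} \<subseteq> S}"

definition L2_space :: "('a::euclidean_space \<Rightarrow> 'b::euclidean_space) set" where
  "L2_space = {f. f \<in> borel_measurable lebesgue \<and> integrable lebesgue (\<lambda>x. (norm (f x))\<^sup>2)}"

definition L2_seminorm :: "('a::euclidean_space \<Rightarrow> 'b::euclidean_space) \<Rightarrow> real" where
  "L2_seminorm f = sqrt (LINT x|lebesgue. (norm (f x))\<^sup>2)"

definition is_weak_gradient :: "('a::euclidean_space \<Rightarrow> real) \<Rightarrow> ('a \<Rightarrow> 'a) \<Rightarrow> bool" where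
  "is_weak_gradient f G \<longleftrightarrow>
     (\<forall>\<phi>\<in>Cc_infinity UNIV. \<forall>b\<in>Basis.
        (LINT x|lebesgue. f x * frechet_derivative \<phi> (at x) b)
          = - (LINT x|lebesgue. (G x \<bullet> b) * \<phi> x))"

definition H1_space :: "('a::euclidean_space \<Rightarrow> real) set" where
  "H1_space = {f \<in> L2_space. \<exists>G\<in>L2_space. is_weak_gradient f G}"

text \<open>The weak gradient is unique almost everywhere; one representative is chosen.\<close>

definition weak_gradient :: "('a::euclidean_space \<Rightarrow> real) \<Rightarrow> 'a \<Rightarrow> 'a" where
  "weak_gradient f = (SOME G. G \<in> L2_space \<and> is_weak_gradient f G)"

definition H1_seminorm :: "('a::euclidean_space \<Rightarrow> real) \<Rightarrow> real" where
  "H1_seminorm f = sqrt ((L2_seminorm f)\<^sup>2 + (L2_seminorm (weak_gradient f))\<^sup>2)"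

definition Lp_loc :: "real \<Rightarrow> 'a::euclidean_space set \<Rightarrow> ('a \<Rightarrow> real) set" where
  "Lp_loc p S =
     {f. f \<in> borel_measurable (lebesgue_on S) \<and>
         (\<forall>K. compact K \<and> K \<subseteq> S \<longrightarrow> set_integrable lebesgue K (\<lambda>z. \<bar>f z\<bar> powr p))}"

text \<open>
  The support, relative to \<open>S\<close>, of the Lebesgue class of a function on \<open>S\<close>: the complement in
  \<open>S\<close> of the largest relatively open set on which the function vanishes almost everywhere.
\<close>

definition ess_support :: "'a::euclidean_space set \<Rightarrow> ('a \<Rightarrow> real) \<Rightarrow> 'a set" where
  "ess_support S f =
     {z \<in> S. \<forall>W. open W \<and> z \<in> W \<longrightarrow> \<not> (AE y in lebesgue. y \<in> W \<inter> S \<longrightarrow> f y = 0)}"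

definition C0_in_time :: "real \<Rightarrow> (('a \<Rightarrow> real) \<Rightarrow> real) \<Rightarrow> ('a \<Rightarrow> real) set \<Rightarrow>
    ('a::euclidean_space \<times> real \<Rightarrow> real) \<Rightarrow> bool" where
  "C0_in_time T N X w \<longleftrightarrow>
     (\<forall>t\<in>{0..<T}. (\<lambda>x. w (x, t)) \<in> X \<and>
        ((\<lambda>s. N (\<lambda>x. w (x, s) - w (x, t))) \<longlongrightarrow> 0) (at t within {0..<T}))"

text \<open>
  \<open>w\<close> belongs to \<open>C\<^sup>1([0,T), L\<^sup>2)\<close> with time derivative \<open>w'\<close>, the derivative being the limit
  of difference quotients in \<open>L\<^sup>2\<close>.
\<close>

definition C1_L2_in_time :: "real \<Rightarrow> ('a::euclidean_space \<times> real \<Rightarrow> real) \<Rightarrow>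
    ('a \<times> real \<Rightarrow> real) \<Rightarrow> bool" where
  "C1_L2_in_time T w w' \<longleftrightarrow>
     C0_in_time T L2_seminorm L2_space w \<and>
     C0_in_time T L2_seminorm L2_space w' \<and>
     (\<forall>t\<in>{0..<T}.
        ((\<lambda>s. L2_seminorm (\<lambda>x. (w (x, s) - w (x, t)) / (s - t) - w' (x, t))) \<longlongrightarrow> 0)
          (at t within {0..<T}))"

definition time_derivative :: "('a::euclidean_space \<times> real \<Rightarrow> real) \<Rightarrow> 'a \<times> real \<Rightarrow> real" where
  "time_derivative \<phi> z = frechet_derivative \<phi> (at z) (0, 1)"

definition space_gradient :: "('a::euclidean_space \<times> real \<Rightarrow> real) \<Rightarrow> 'a \<times> real \<Rightarrow> 'a" where
  "space_gradient \<phi> z = (\<Sum>b\<in>Basis. frechet_derivative \<phi> (at z) (b, 0) *\<^sub>R b)"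

text \<open>
  The test functions on \<open>\<real>\<^sup>n \<times> [0,T)\<close>, smooth up to \<open>t = 0\<close> and not required to vanish there,
  are the restrictions of the test functions on \<open>\<real>\<^sup>n \<times> (-\<infinity>,T)\<close>. Their values for
  \<open>t < 0\<close> do not enter.
\<close>

definition energy_solution ::
  "real \<Rightarrow> real \<Rightarrow> real \<Rightarrow> ('a::euclidean_space \<Rightarrow> real) \<Rightarrow> ('a \<Rightarrow> real) \<Rightarrow> real \<Rightarrow>
   ('a \<times> real \<Rightarrow> real) \<Rightarrow> bool" where
  "energy_solution p \<mu> \<beta> u0 u1 T u \<longleftrightarrow>
     C0_in_time T H1_seminorm H1_space u \<and>
     u \<in> Lp_loc p (UNIV \<times> {0<..<T}) \<and>
     (\<exists>ut. C1_L2_in_time T u ut \<and>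
       (AE x in lebesgue. u (x, 0) = u0 x) \<and>
       (AE x in lebesgue. ut (x, 0) = u1 x) \<and>
       (\<forall>\<phi>\<in>Cc_infinity (UNIV \<times> {..<T}). \<forall>t\<in>{0..<T}.
          (LINT x|lebesgue. ut (x, t) * \<phi> (x, t)) - (LINT x|lebesgue. ut (x, 0) * \<phi> (x, 0))
          + (LINT s:{0..t}|lebesgue. (LINT x|lebesgue.
               - ut (x, s) * time_derivative \<phi> (x, s)
               + weak_gradient (\<lambda>y. u (y, s)) x \<bullet> space_gradient \<phi> (x, s)))
          + (LINT s:{0..t}|lebesgue. (LINT x|lebesgue.
               \<mu> * ut (x, s) / (1 + s) powr \<beta> * \<phi> (x, s)))
          = (LINT s:{0..t}|lebesgue. (LINT x|lebesgue. \<bar>u (x, s)\<bar> powr p * \<phi> (x, s)))))"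

end

theory Submission
  imports Defs
begin

text \<open>
  Fix a cutoff \<open>\<zeta>\<close> which is \<open>1\<close> on a ball of radius at least \<open>T + R\<close>, and let \<open>F t\<close> be the integral of
  \<open>u(\<cdot>,t) \<zeta>\<close>, that is, of \<open>u(\<cdot>,t)\<close>. Testing the equation with \<open>\<zeta>\<close> gives
  \<open>F'' + \<mu> (1 + t) powr - \<beta> * F' = \<integral> \<bar>u\<bar> powr p\<close>. As \<open>\<beta> > 1\<close>, the damping has a bounded integrating
  factor and costs only a constant, so \<open>F' \<ge> a \<epsilon> + c \<integral> (s + R) powr (- 2 (p - 1)) * F powr p\<close> by
  Hoelder's inequality on the ball of radius \<open>s + R\<close>; the term \<open>a \<epsilon>\<close> comes from \<open>\<integral> g > 0\<close>.
  In particular \<open>F t \<ge> a \<epsilon> t\<close>. On \<open>[S, 2 S]\<close> with \<open>S \<ge> R\<close> the weight is at least a multiple of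
  \<open>S powr (- 2 (p - 1))\<close>, and \<open>F\<close> dominates the explicit solution \<open>\<kappa> (2 S - t) powr (- 2 / (p - 1))\<close>,
  \<open>\<kappa>\<close> a multiple of \<open>S\<^sup>2\<close>, as soon as \<open>a \<epsilon> > D S powr (- (3 - p) / (p - 1))\<close>. Such an \<open>S\<close> therefore
  cannot satisfy \<open>2 S < T\<close>.
\<close>

section \<open>Smooth functions and cutoffs\<close>

lemma Ck_SucD: "Ck (Suc k) \<phi> \<Longrightarrow> Ck k \<phi>"
proof (induction k arbitrary: \<phi>)
  case 0
  then show ?case
    by (auto intro!: differentiable_imp_continuous_on simp: differentiable_on_def)
next
  case (Suc k)
  then show ?case by (metis Ck.simps(2))
qed

lemma Ck_has_derivative:
  assumes "Ck (Suc k) \<phi>"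
  shows "(\<phi> has_derivative frechet_derivative \<phi> (at x)) (at x)"
  using assms frechet_derivative_works by auto

lemma Ck_SucI:
  assumes "\<And>x. (\<phi> has_derivative D x) (at x)" and "\<And>b. b \<in> Basis \<Longrightarrow> Ck k (\<lambda>x. D x b)"
  shows "Ck (Suc k) \<phi>"
proof -
  have "frechet_derivative \<phi> (at x) = D x" for x
    using frechet_derivative_at[OF assms(1)] by simp
  with assms show ?thesis by (auto simp: differentiable_def)
qed

lemma Ck_const: "Ck k (\<lambda>x. c)"
proof (induction k arbitrary: c)
  case (Suc k)
  show ?case by (rule Ck_SucI[where D="\<lambda>x b. 0"]) (auto intro: Suc)
qed simp

lemma Ck_bounded_linear:
  assumes "bounded_linear L"
  shows "Ck k L"
proof (cases k)
  case 0
  then show ?thesis using assms by (simp add: linear_continuous_on)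
next
  case (Suc k)
  show ?thesis unfolding Suc
    by (rule Ck_SucI[where D="\<lambda>x. L"]) (auto intro: Ck_const bounded_linear_imp_has_derivative assms)
qed

lemma Ck_add: "Ck k \<phi> \<Longrightarrow> Ck k \<psi> \<Longrightarrow> Ck k (\<lambda>x. \<phi> x + \<psi> x)"
proof (induction k arbitrary: \<phi> \<psi>)
  case 0
  then show ?case by (auto intro: continuous_intros)
next
  case (Suc k)
  show ?case
  proof (rule Ck_SucI)
    show "((\<lambda>x. \<phi> x + \<psi> x) has_derivative
        (\<lambda>h. frechet_derivative \<phi> (at x) h + frechet_derivative \<psi> (at x) h)) (at x)" for x
      using Suc.prems by (intro has_derivative_add Ck_has_derivative)
    show "Ck k (\<lambda>x. frechet_derivative \<phi> (at x) b + frechet_derivative \<psi> (at x) b)"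
      if "b \<in> Basis" for b
      using Suc that by simp
  qed
qed

lemma Ck_mult: "Ck k \<phi> \<Longrightarrow> Ck k \<psi> \<Longrightarrow> Ck k (\<lambda>x. \<phi> x * \<psi> x)"
proof (induction k arbitrary: \<phi> \<psi>)
  case 0
  then show ?case by (auto intro: continuous_intros)
next
  case (Suc k)
  show ?case
  proof (rule Ck_SucI)
    show "((\<lambda>x. \<phi> x * \<psi> x) has_derivative
        (\<lambda>h. \<phi> x * frechet_derivative \<psi> (at x) h + frechet_derivative \<phi> (at x) h * \<psi> x)) (at x)" for x
      using Suc.prems by (intro has_derivative_mult Ck_has_derivative)
    show "Ck k (\<lambda>x. \<phi> x * frechet_derivative \<psi> (at x) b + frechet_derivative \<phi> (at x) b * \<psi> x)"
      if "b \<in> Basis" for b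
      using Suc.prems that Suc.prems[THEN Ck_SucD] by (intro Ck_add Suc.IH) auto
  qed
qed

text \<open>The derivative of the inverse is built from the inverse itself and the derivative of
  \<open>\<phi>\<close>, so the induction hypothesis for the same \<open>\<phi>\<close>, one order
  lower, closes the step.\<close>

lemma Ck_inverse:
  assumes "\<And>x. \<phi> x \<noteq> 0"
  shows "Ck k \<phi> \<Longrightarrow> Ck k (\<lambda>x. inverse (\<phi> x))"
proof (induction k)
  case 0
  then show ?case using assms by (auto intro!: continuous_intros)
next
  case (Suc k)
  show ?case
  proof (rule Ck_SucI)
    show "((\<lambda>x. inverse (\<phi> x)) has_derivative
        (\<lambda>h. - (inverse (\<phi> x) * frechet_derivative \<phi> (at x) h * inverse (\<phi> x)))) (at x)" for x
      using Suc.prems assms by (intro Deriv.has_derivative_inverse Ck_has_derivative)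
    have "Ck k (\<lambda>x. (-1) * (inverse (\<phi> x) * frechet_derivative \<phi> (at x) b * inverse (\<phi> x)))"
      if "b \<in> Basis" for b
      using Suc.prems that Suc.IH Ck_SucD by (intro Ck_mult Ck_const) auto
    then show "Ck k (\<lambda>x. - (inverse (\<phi> x) * frechet_derivative \<phi> (at x) b * inverse (\<phi> x)))"
      if "b \<in> Basis" for b using that by simp
  qed
qed

text \<open>The induction varies only \<open>h\<close>: the chain rule replaces \<open>h\<close> by
  its derivative and keeps \<open>q\<close>, whose own derivative enters as a factor. On the real
  line the derivative of \<open>h\<close> is multiplication by its value at \<open>1\<close>, which
  is again a function composed with \<open>q\<close>.\<close>

lemma Ck_compose:
  fixes h :: "real \<Rightarrow> real"
  shows "Ck k h \<Longrightarrow> Ck k q \<Longrightarrow> Ck k (\<lambda>x. h (q x))"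
proof (induction k arbitrary: h)
  case 0
  then show ?case
    by (auto intro: continuous_on_compose2)
next
  case (Suc k)
  show ?case
  proof (rule Ck_SucI)
    have lin: "frechet_derivative h (at y) r = r * frechet_derivative h (at y) 1" for y r
      using linear_scale[OF has_derivative_linear[OF Ck_has_derivative[OF Suc.prems(1)]], of y r 1]
      by simp
    show "((\<lambda>x. h (q x)) has_derivative
        (\<lambda>v. frechet_derivative h (at (q x)) 1 * frechet_derivative q (at x) v)) (at x)" for x
    proof -
      have "(q has_derivative frechet_derivative q (at x)) (at x)"
        and "(h has_derivative frechet_derivative h (at (q x))) (at (q x))"
        by (rule Ck_has_derivative[OF Suc.prems(2)], rule Ck_has_derivative[OF Suc.prems(1)])
      then have "((\<lambda>x. h (q x)) has_derivative
          (\<lambda>v. frechet_derivative h (at (q x)) (frechet_derivative q (at x) v))) (at x)"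
        by (rule has_derivative_compose)
      also have "(\<lambda>v. frechet_derivative h (at (q x)) (frechet_derivative q (at x) v))
          = (\<lambda>v. frechet_derivative h (at (q x)) 1 * frechet_derivative q (at x) v)"
        by (rule ext, subst lin, rule mult.commute)
      finally show ?thesis .
    qed
    show "Ck k (\<lambda>x. frechet_derivative h (at (q x)) 1 * frechet_derivative q (at x) b)"
      if "b \<in> Basis" for b
      using Suc.prems that
      by (intro Ck_mult Suc.IH[where h="\<lambda>y. frechet_derivative h (at y) 1"] Ck_SucD[OF Suc.prems(2)]) auto
  qed
qed

text \<open>Cutoffs are built from the squared norm, since the norm is not differentiable at the
  origin. The linear map \<open>L\<close> covers both the identity on space and the projection
  \<open>fst\<close> from space-time.\<close>

lemma Ck_inner_self:
  fixes L :: "'a::euclidean_space \<Rightarrow> 'b::euclidean_space"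
  assumes "bounded_linear L"
  shows "Ck k (\<lambda>z. L z \<bullet> L z)"
proof (cases k)
  case 0
  then show ?thesis using assms by (simp add: continuous_on_inner linear_continuous_on)
next
  case (Suc k)
  show ?thesis unfolding Suc
  proof (rule Ck_SucI)
    show "((\<lambda>z. L z \<bullet> L z) has_derivative (\<lambda>h. L z \<bullet> L h + L h \<bullet> L z)) (at z)" for z
      by (intro has_derivative_inner bounded_linear_imp_has_derivative assms)
    have "bounded_linear (\<lambda>z. L z \<bullet> L b)" for b
      using bounded_linear_compose[OF bounded_linear_inner_left assms] .
    then show "Ck k (\<lambda>z. L z \<bullet> L b + L b \<bullet> L z)" for b
      by (subst inner_commute[of "L b"], intro Ck_add Ck_bounded_linear)
  qed
qed

text \<open>Polynomials in \<open>1 / x\<close> are included because this class is closed under differentiation.\<close>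

definition flat_exp :: "real poly \<Rightarrow> real \<Rightarrow> real" where
  "flat_exp q x = (if x > 0 then poly q (1 / x) * exp (- (1 / x)) else 0)"

lemma tendsto_poly_exp_neg: "((\<lambda>y::real. poly q y * exp (- y)) \<longlongrightarrow> 0) at_top"
proof -
  have eq: "(\<lambda>y. poly q y * exp (- y)) = (\<lambda>y. \<Sum>i\<le>degree q. coeff q i * (y ^ i / exp y))"
    by (simp add: poly_altdef sum_divide_distrib exp_minus divide_inverse sum_distrib_right mult.assoc)
  have "((\<lambda>y. \<Sum>i\<le>degree q. coeff q i * (y ^ i / exp y)) \<longlongrightarrow> (\<Sum>i\<le>degree q. coeff q i * 0)) at_top"
    by (intro tendsto_intros tendsto_power_div_exp_0)
  then show ?thesis unfolding eq by simp
qed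

text \<open>For \<open>x > 0\<close> both the polynomial and the exponential contribute the inner
  derivative of \<open>1 / x\<close>, and its factor \<open>1 / x\<^sup>2\<close> becomes
  \<open>monom 1 2\<close>.\<close>

lemma flat_exp_has_derivative:
  "(flat_exp q has_real_derivative flat_exp (monom 1 2 * (q - pderiv q)) x) (at x)"
proof -
  consider "x < 0" | "x = 0" | "x > 0" by linarith
  then show ?thesis
  proof cases
    case 1
    have "((\<lambda>x. 0::real) has_real_derivative 0) (at x)" by simp
    then have "(flat_exp q has_real_derivative 0) (at x)"
      by (rule has_field_derivative_transform_within_open[where S="{..<0}"])
        (use 1 in \<open>auto simp: flat_exp_def\<close>)
    with 1 show ?thesis by (simp add: flat_exp_def)
  next
    case 2
    \<comment> \<open>Dividing by \<open>h\<close> multiplies the polynomial in \<open>1 / h\<close>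
      by its variable, which is what \<open>pCons 0\<close> does; exponential decay still
      wins.\<close>
    have "((\<lambda>h. poly (pCons 0 q) (1 / h) * exp (- (1 / h))) \<longlongrightarrow> 0) (at_right 0)"
      using filterlim_compose[OF tendsto_poly_exp_neg[of "pCons 0 q"] filterlim_inverse_at_top_right]
      by (simp add: inverse_eq_divide)
    then have "((\<lambda>h. flat_exp q h / h) \<longlongrightarrow> 0) (at_right 0)"
      by (rule tendsto_cong[THEN iffD1, rotated])
        (auto simp: flat_exp_def eventually_at_filter)
    moreover have "((\<lambda>h. flat_exp q h / h) \<longlongrightarrow> 0) (at_left 0)"
      by (rule tendsto_eventually) (auto simp: flat_exp_def eventually_at_filter)
    ultimately have "((\<lambda>h. flat_exp q h / h) \<longlongrightarrow> 0) (at 0)"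
      by (simp add: filterlim_split_at)
    with 2 show ?thesis
      by (simp add: has_field_derivative_iff flat_exp_def)
  next
    case 3
    have inv: "((\<lambda>x. 1 / x) has_real_derivative - (1 / x\<^sup>2)) (at x)"
      using 3 by (auto intro!: derivative_eq_intros simp: power2_eq_square)
    have "((\<lambda>x. poly q (1 / x) * exp (- (1 / x))) has_real_derivative
        poly (pderiv q) (1 / x) * - (1 / x\<^sup>2) * exp (- (1 / x))
        + exp (- (1 / x)) * - (- (1 / x\<^sup>2)) * poly q (1 / x)) (at x)"
      by (intro DERIV_mult DERIV_chain2[OF DERIV_exp] DERIV_chain2[OF poly_DERIV] DERIV_minus inv)
    also have "poly (pderiv q) (1 / x) * - (1 / x\<^sup>2) * exp (- (1 / x))
        + exp (- (1 / x)) * - (- (1 / x\<^sup>2)) * poly q (1 / x) = flat_exp (monom 1 2 * (q - pderiv q)) x"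
      using 3 by (simp add: flat_exp_def poly_monom power_one_over algebra_simps)
    finally have "((\<lambda>x. poly q (1 / x) * exp (- (1 / x))) has_real_derivative
        flat_exp (monom 1 2 * (q - pderiv q)) x) (at x)" .
    then show ?thesis
      by (rule has_field_derivative_transform_within_open[where S="{0<..}"])
        (use 3 in \<open>auto simp: flat_exp_def\<close>)
  qed
qed

lemma Ck_flat_exp: "Ck k (flat_exp q)"
proof (induction k arbitrary: q)
  case 0
  show ?case
    by (simp add: continuous_at_imp_continuous_on DERIV_isCont[OF flat_exp_has_derivative])
next
  case (Suc k)
  show ?case
    by (rule Ck_SucI[OF flat_exp_has_derivative[unfolded has_field_derivative_def]])
      (use Suc in simp)
qed

lemma ex_smooth_step:
  "\<exists>H::real \<Rightarrow> real. smooth H \<and> (\<forall>y\<le>0. H y = 0) \<and> (\<forall>y\<ge>1. H y = 1) \<and> (\<forall>y. 0 \<le> H y \<and> H y \<le> 1)"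
proof -
  define h where "h = flat_exp 1"
  have h: "h y \<ge> 0" "y > 0 \<Longrightarrow> h y > 0" "y \<le> 0 \<Longrightarrow> h y = 0" for y
    by (auto simp: h_def flat_exp_def)
  \<comment> \<open>The numbers \<open>y\<close> and \<open>1 - y\<close> are never both
    nonpositive, so the denominator of the step function does not vanish.\<close>
  have pos: "h y + h (1 - y) > 0" for y
    using h(1)[of y] h(1)[of "1 - y"] h(2)[of y] h(2)[of "1 - y"] by (cases "y > 0") auto
  define H where "H y = h y * inverse (h y + h (1 - y))" for y
  have Ckh: "Ck k h" for k unfolding h_def by (rule Ck_flat_exp)
  have "Ck k (\<lambda>y. 1 + - y)" for k
    by (intro Ck_add Ck_const Ck_bounded_linear bounded_linear_minus bounded_linear_ident)
  from Ck_compose[OF Ckh this] have "Ck k (\<lambda>y. h (1 - y))" for k by simp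
  then have "Ck k H" for k unfolding H_def
    using pos by (intro Ck_mult Ck_inverse Ck_add Ckh) (simp_all add: less_imp_neq[symmetric])
  moreover have "H y = 0" if "y \<le> 0" for y using h(3)[OF that] by (simp add: H_def)
  moreover have "H y = 1" if "y \<ge> 1" for y using h(2)[of y] h(3)[of "1 - y"] that by (simp add: H_def)
  moreover have "0 \<le> H y" "H y \<le> 1" for y
    using h(1)[of y] h(1)[of "1 - y"] pos[of y] by (auto simp: H_def divide_simps)
  ultimately show ?thesis unfolding smooth_def by blast
qed

section \<open>Square-integrable functions\<close>

lemma L2_measurable [measurable_dest]: "f \<in> L2_space \<Longrightarrow> f \<in> borel_measurable lebesgue"
  by (simp add: L2_space_def)

lemma L2_integrable_sq:
  fixes f :: "'a::euclidean_space \<Rightarrow> real"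
  shows "f \<in> L2_space \<Longrightarrow> integrable lebesgue (\<lambda>x. (f x)\<^sup>2)"
  by (simp add: L2_space_def)

lemma L2_seminorm_real:
  fixes f :: "'a::euclidean_space \<Rightarrow> real"
  shows "(L2_seminorm f)\<^sup>2 = (LINT x|lebesgue. (f x)\<^sup>2)"
  by (simp add: L2_seminorm_def)

lemma L2_mult_integrable:
  fixes f g :: "'a::euclidean_space \<Rightarrow> real"
  assumes "f \<in> L2_space" "g \<in> L2_space"
  shows "integrable lebesgue (\<lambda>x. f x * g x)"
proof (rule Bochner_Integration.integrable_bound)
  show "integrable lebesgue (\<lambda>x. (f x)\<^sup>2 + (g x)\<^sup>2)"
    using assms by (intro Bochner_Integration.integrable_add L2_integrable_sq)
  have "\<bar>a * b\<bar> \<le> a\<^sup>2 + b\<^sup>2" for a b :: real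
    using sum_squares_bound[of "\<bar>a\<bar>" "\<bar>b\<bar>"] abs_ge_zero[of "a * b"]
    unfolding abs_mult power2_abs by linarith
  then show "AE x in lebesgue. norm (f x * g x) \<le> norm ((f x)\<^sup>2 + (g x)\<^sup>2)"
    by simp
qed (use assms in measurable)

lemma L2_add:
  fixes f g :: "'a::euclidean_space \<Rightarrow> real"
  assumes "f \<in> L2_space" "g \<in> L2_space"
  shows "(\<lambda>x. f x + g x) \<in> L2_space"
proof -
  have "integrable lebesgue (\<lambda>x. (f x)\<^sup>2 + (g x)\<^sup>2 + 2 * (f x * g x))"
    using assms by (intro Bochner_Integration.integrable_add L2_integrable_sq
        integrable_mult_right L2_mult_integrable)
  moreover have "(\<lambda>x. f x + g x) \<in> borel_measurable lebesgue" using assms by measurable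
  ultimately show ?thesis by (simp add: L2_space_def power2_sum mult.assoc)
qed

lemma L2_cmult:
  fixes f :: "'a::euclidean_space \<Rightarrow> real"
  assumes "f \<in> L2_space"
  shows "(\<lambda>x. c * f x) \<in> L2_space"
proof -
  have "(\<lambda>x. c * f x) \<in> borel_measurable lebesgue" using assms by measurable
  with assms show ?thesis by (simp add: L2_space_def power_mult_distrib)
qed

lemma L2_diff:
  fixes f g :: "'a::euclidean_space \<Rightarrow> real"
  assumes "f \<in> L2_space" "g \<in> L2_space"
  shows "(\<lambda>x. f x - g x) \<in> L2_space"
  using L2_add[OF assms(1) L2_cmult[OF assms(2), of "-1"]] by simp

lemma L2_abs:
  fixes f :: "'a::euclidean_space \<Rightarrow> real"
  shows "f \<in> L2_space \<Longrightarrow> (\<lambda>x. \<bar>f x\<bar>) \<in> L2_space"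
  by (auto simp: L2_space_def)

lemma L2_seminorm_abs:
  fixes f :: "'a::euclidean_space \<Rightarrow> real"
  shows "L2_seminorm (\<lambda>x. \<bar>f x\<bar>) = L2_seminorm f"
  by (simp add: L2_seminorm_def)

lemma L2_inner_right:
  fixes G :: "'a::euclidean_space \<Rightarrow> 'b::euclidean_space"
  assumes "G \<in> L2_space"
  shows "(\<lambda>x. G x \<bullet> b) \<in> L2_space"
proof -
  have [measurable]: "G \<in> borel_measurable lebesgue" using assms by (simp add: L2_space_def)
  have "integrable lebesgue (\<lambda>x. (G x \<bullet> b)\<^sup>2)"
  proof (rule Bochner_Integration.integrable_bound)
    show "integrable lebesgue (\<lambda>x. (norm b)\<^sup>2 * (norm (G x))\<^sup>2)"
      using assms by (simp add: L2_space_def)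
    have "(G x \<bullet> b)\<^sup>2 \<le> (norm b)\<^sup>2 * (norm (G x))\<^sup>2" for x
      using Cauchy_Schwarz_ineq[of "G x" b] by (simp add: power2_norm_eq_inner mult.commute)
    then show "AE x in lebesgue. norm ((G x \<bullet> b)\<^sup>2) \<le> norm ((norm b)\<^sup>2 * (norm (G x))\<^sup>2)"
      by simp
  qed measurable
  then show ?thesis by (simp add: L2_space_def)
qed

text \<open>The integral of \<open>(f + c g)\<^sup>2\<close> is a nonnegative quadratic polynomial
  in \<open>c\<close>, which bounds its discriminant.\<close>

lemma L2_Cauchy_Schwarz:
  fixes f g :: "'a::euclidean_space \<Rightarrow> real"
  assumes f: "f \<in> L2_space" and g: "g \<in> L2_space"
  shows "\<bar>LINT x|lebesgue. f x * g x\<bar> \<le> L2_seminorm f * L2_seminorm g"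
proof -
  define A where "A = (LINT x|lebesgue. (f x)\<^sup>2)"
  define B where "B = (LINT x|lebesgue. f x * g x)"
  define C where "C = (LINT x|lebesgue. (g x)\<^sup>2)"
  have nonneg: "0 \<le> A + 2 * c * B + c\<^sup>2 * C" for c
  proof -
    have "0 \<le> (LINT x|lebesgue. (f x)\<^sup>2 + (2 * c) * (f x * g x) + c\<^sup>2 * (g x)\<^sup>2)"
    proof (rule integral_nonneg_AE, rule AE_I2)
      have "(f x)\<^sup>2 + (2 * c) * (f x * g x) + c\<^sup>2 * (g x)\<^sup>2 = (f x + c * g x)\<^sup>2" for x
        by (simp add: power2_eq_square algebra_simps)
      then show "0 \<le> (f x)\<^sup>2 + (2 * c) * (f x * g x) + c\<^sup>2 * (g x)\<^sup>2" for x by simp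
    qed
    also have "\<dots> = A + 2 * c * B + c\<^sup>2 * C"
      using L2_integrable_sq[OF f] L2_integrable_sq[OF g] L2_mult_integrable[OF f g]
      by (simp add: A_def B_def C_def)
    finally show ?thesis .
  qed
  have "C \<ge> 0" unfolding C_def by simp
  have "B\<^sup>2 \<le> A * C"
  proof (cases "C = 0")
    case True
    have "B = 0"
    proof (rule ccontr)
      assume "B \<noteq> 0"
      \<comment> \<open>With \<open>C = 0\<close> the polynomial is affine in \<open>c\<close>, and
        this \<open>c\<close> gives it the value \<open>-1\<close>.\<close>
      then show False using nonneg[of "- (A + 1) / (2 * B)"] True by (simp add: field_simps)
    qed
    with True show ?thesis by simp
  next
    case False
    then show ?thesis using nonneg[of "- B / C"] \<open>C \<ge> 0\<close>
      by (simp add: field_simps power2_eq_square)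
  qed
  then have "\<bar>B\<bar> \<le> sqrt (A * C)" by (rule real_le_rsqrt[of "\<bar>B\<bar>", unfolded power2_abs])
  then show ?thesis by (simp add: A_def B_def C_def L2_seminorm_def real_sqrt_mult)
qed

section \<open>Curves in the space of square-integrable functions, paired with a fixed
  function\<close>

lemma C0_in_time_L2_slice: "C0_in_time T N X w \<Longrightarrow> t \<in> {0..<T} \<Longrightarrow> (\<lambda>x. w (x, t)) \<in> X"
  by (simp add: C0_in_time_def)

lemma continuous_on_L2_pairing:
  assumes w: "C0_in_time T L2_seminorm L2_space w" and \<psi>: "\<psi> \<in> L2_space"
  shows "continuous_on {0..<T} (\<lambda>t. LINT x|lebesgue. w (x, t) * \<psi> x)"
  unfolding continuous_on_def
proof
  fix t assume t: "t \<in> {0..<T}"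
  have slice: "(\<lambda>x. w (x, s)) \<in> L2_space" if "s \<in> {0..<T}" for s
    using w that by (rule C0_in_time_L2_slice)
  have "((\<lambda>s. (LINT x|lebesgue. w (x, s) * \<psi> x) - (LINT x|lebesgue. w (x, t) * \<psi> x)) \<longlongrightarrow> 0)
      (at t within {0..<T})"
  proof (rule Lim_null_comparison)
    show "\<forall>\<^sub>F s in at t within {0..<T}.
        norm ((LINT x|lebesgue. w (x, s) * \<psi> x) - (LINT x|lebesgue. w (x, t) * \<psi> x))
        \<le> L2_seminorm (\<lambda>x. w (x, s) - w (x, t)) * L2_seminorm \<psi>"
      unfolding eventually_at_filter
    proof (rule always_eventually, intro allI impI)
      fix s assume s: "s \<in> {0..<T}"
      have "(LINT x|lebesgue. w (x, s) * \<psi> x) - (LINT x|lebesgue. w (x, t) * \<psi> x)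
          = (LINT x|lebesgue. (w (x, s) - w (x, t)) * \<psi> x)"
        using slice[OF s] slice[OF t] \<psi>
        by (simp add: left_diff_distrib Bochner_Integration.integral_diff L2_mult_integrable)
      then show "norm ((LINT x|lebesgue. w (x, s) * \<psi> x) - (LINT x|lebesgue. w (x, t) * \<psi> x))
          \<le> L2_seminorm (\<lambda>x. w (x, s) - w (x, t)) * L2_seminorm \<psi>"
        using L2_Cauchy_Schwarz[OF L2_diff[OF slice[OF s] slice[OF t]] \<psi>] by simp
    qed
    show "((\<lambda>s. L2_seminorm (\<lambda>x. w (x, s) - w (x, t)) * L2_seminorm \<psi>) \<longlongrightarrow> 0)
        (at t within {0..<T})"
      using w t by (intro tendsto_mult_left_zero) (simp add: C0_in_time_def)
  qed
  then show "((\<lambda>s. LINT x|lebesgue. w (x, s) * \<psi> x) \<longlongrightarrow> (LINT x|lebesgue. w (x, t) * \<psi> x))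
      (at t within {0..<T})"
    by (simp add: Lim_null[symmetric])
qed

text \<open>Difference quotients converge in norm, and the Cauchy-Schwarz inequality carries this
  over to the pairing. The derivative is one-sided at \<open>t = 0\<close>.\<close>

lemma has_derivative_L2_pairing:
  assumes w: "C1_L2_in_time T w w'" and \<psi>: "\<psi> \<in> L2_space" and t: "t \<in> {0..<T}"
  shows "((\<lambda>t. LINT x|lebesgue. w (x, t) * \<psi> x) has_real_derivative
    (LINT x|lebesgue. w' (x, t) * \<psi> x)) (at t within {0..<T})"
proof -
  let ?I = "\<lambda>s. LINT x|lebesgue. w (x, s) * \<psi> x"
  let ?d = "\<lambda>s x. (w (x, s) - w (x, t)) / (s - t) - w' (x, t)"
  have slice: "(\<lambda>x. w (x, s)) \<in> L2_space" "(\<lambda>x. w' (x, s)) \<in> L2_space" if "s \<in> {0..<T}" for s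
    using w that by (auto simp: C1_L2_in_time_def intro: C0_in_time_L2_slice)
  have "((\<lambda>s. (?I s - ?I t) / (s - t) - (LINT x|lebesgue. w' (x, t) * \<psi> x)) \<longlongrightarrow> 0)
      (at t within {0..<T})"
  proof (rule Lim_null_comparison)
    show "\<forall>\<^sub>F s in at t within {0..<T}.
        norm ((?I s - ?I t) / (s - t) - (LINT x|lebesgue. w' (x, t) * \<psi> x))
        \<le> L2_seminorm (?d s) * L2_seminorm \<psi>"
      unfolding eventually_at_filter
    proof (rule always_eventually, intro allI impI)
      fix s assume s: "s \<in> {0..<T}"
      have q: "(\<lambda>x. inverse (s - t) * (w (x, s) - w (x, t))) \<in> L2_space"
        by (intro L2_cmult L2_diff slice s t)
      have "(?I s - ?I t) / (s - t) - (LINT x|lebesgue. w' (x, t) * \<psi> x)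
          = (LINT x|lebesgue. inverse (s - t) * (w (x, s) * \<psi> x - w (x, t) * \<psi> x) - w' (x, t) * \<psi> x)"
        using slice[OF s] slice[OF t] \<psi>
        by (simp add: L2_mult_integrable divide_inverse mult.commute[of "inverse (s - t)"])
      also have "\<dots> = (LINT x|lebesgue. ?d s x * \<psi> x)"
        by (rule Bochner_Integration.integral_cong) (simp_all add: algebra_simps divide_inverse)
      finally show "norm ((?I s - ?I t) / (s - t) - (LINT x|lebesgue. w' (x, t) * \<psi> x))
          \<le> L2_seminorm (?d s) * L2_seminorm \<psi>"
        using L2_Cauchy_Schwarz[OF L2_diff[OF q slice(2)[OF t]] \<psi>]
        by (simp add: divide_inverse mult.commute)
    qed
    show "((\<lambda>s. L2_seminorm (?d s) * L2_seminorm \<psi>) \<longlongrightarrow> 0) (at t within {0..<T})"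
      using w t by (intro tendsto_mult_left_zero) (simp add: C1_L2_in_time_def)
  qed
  then show ?thesis
    unfolding has_field_derivative_iff by (rule Lim_null[THEN iffD2])
qed

section \<open>The power nonlinearity\<close>

text \<open>Young's inequality with exponents \<open>p\<close> and \<open>p / (p - 1)\<close>,
  applied to \<open>x\<close> and \<open>c powr (p - 1)\<close>. The right side is the tangent line
  of the power at \<open>c\<close>.\<close>

lemma powr_above_tangent:
  fixes x c p :: real
  assumes "p > 1" "x \<ge> 0" "c \<ge> 0"
  shows "x powr p \<ge> p * c powr (p - 1) * x - (p - 1) * c powr p"
proof -
  have "x * c powr (p - 1) \<le> x powr p / p + (c powr (p - 1)) powr (p / (p - 1)) / (p / (p - 1))"
    using assms by (intro Youngs_inequality) (auto simp: field_simps)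
  also have "(c powr (p - 1)) powr (p / (p - 1)) = c powr p"
    using assms by (simp add: powr_powr)
  finally show ?thesis using assms by (simp add: field_simps)
qed

text \<open>The tangent at the larger point bounds the difference, and for \<open>p < 2\<close> its
  slope grows at most linearly. The resulting bound is quadratic, so that norms of square-integrable
  functions control the nonlinearity.\<close>

lemma abs_powr_diff_le:
  fixes a b p :: real
  assumes p: "1 < p" "p < 2"
  shows "\<bar>\<bar>a\<bar> powr p - \<bar>b\<bar> powr p\<bar> \<le> 2 * (1 + \<bar>a\<bar> + \<bar>b\<bar>) * \<bar>a - b\<bar>"
proof -
  have ge: "x powr p - y powr p \<le> 2 * (1 + x + y) * (x - y)" if "0 \<le> y" "y \<le> x" for x y :: real
  proof -
    have "x powr p = x * x powr (p - 1)"
      using p that by (metis diff_add_cancel add.commute powr_add powr_one order_trans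
        mult.commute)
    then have "x powr p - y powr p \<le> p * x powr (p - 1) * (x - y)"
      using powr_above_tangent[of p y x] p that by (simp add: algebra_simps)
    also have "\<dots> \<le> 2 * (1 + x + y) * (x - y)"
    proof (intro mult_right_mono mult_mono)
      show "x powr (p - 1) \<le> 1 + x + y"
      proof (cases "x \<ge> 1")
        case True
        then have "x powr (p - 1) \<le> x powr 1" using p by (intro powr_mono) auto
        with True that show ?thesis by simp
      next
        case False
        then have "x powr (p - 1) \<le> 1" using p that by (intro powr_le1) auto
        with that show ?thesis by simp
      qed
    qed (use p that in auto)
    finally show ?thesis .
  qed
  have "\<bar>\<bar>a\<bar> powr p - \<bar>b\<bar> powr p\<bar> \<le> 2 * (1 + \<bar>a\<bar> + \<bar>b\<bar>) * \<bar>\<bar>a\<bar> - \<bar>b\<bar>\<bar>"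
  proof (cases "\<bar>b\<bar> \<le> \<bar>a\<bar>")
    case True
    then have "\<bar>b\<bar> powr p \<le> \<bar>a\<bar> powr p" using p by (intro powr_mono2) auto
    with True ge[of "\<bar>b\<bar>" "\<bar>a\<bar>"] show ?thesis by simp
  next
    case False
    then have "\<bar>a\<bar> powr p \<le> \<bar>b\<bar> powr p" using p by (intro powr_mono2) auto
    with False ge[of "\<bar>a\<bar>" "\<bar>b\<bar>"] show ?thesis by (simp add: algebra_simps)
  qed
  also have "\<dots> \<le> 2 * (1 + \<bar>a\<bar> + \<bar>b\<bar>) * \<bar>a - b\<bar>"
    by (intro mult_left_mono) auto
  finally show ?thesis .
qed

lemma integrable_powr_weight:
  fixes v \<psi> :: "'a::euclidean_space \<Rightarrow> real"
  assumes p: "1 < p" "p < 2" and v: "v \<in> L2_space" and \<psi>: "\<psi> \<in> L2_space"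
    and \<psi>01: "\<And>x. 0 \<le> \<psi> x" "\<And>x. \<psi> x \<le> 1"
  shows "integrable lebesgue (\<lambda>x. \<bar>v x\<bar> powr p * \<psi> x)"
proof (rule Bochner_Integration.integrable_bound)
  show "integrable lebesgue (\<lambda>x. 2 * (\<bar>v x\<bar> * \<psi> x) + 2 * (v x)\<^sup>2)"
    using v \<psi> by (intro Bochner_Integration.integrable_add integrable_mult_right
        L2_integrable_sq L2_mult_integrable L2_abs)
  have "\<bar>v x\<bar> powr p * \<psi> x \<le> 2 * (\<bar>v x\<bar> * \<psi> x) + 2 * (v x)\<^sup>2" for x
  proof -
    have "\<bar>v x\<bar> powr p * \<psi> x \<le> 2 * (1 + \<bar>v x\<bar>) * \<bar>v x\<bar> * \<psi> x"
      using abs_powr_diff_le[OF p, of "v x" 0] \<psi>01 by (intro mult_right_mono) auto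
    also have "\<dots> = 2 * (\<bar>v x\<bar> * \<psi> x) + 2 * (v x)\<^sup>2 * \<psi> x"
      by (simp add: algebra_simps power2_eq_square abs_mult_self_eq)
    also have "\<dots> \<le> 2 * (\<bar>v x\<bar> * \<psi> x) + 2 * (v x)\<^sup>2"
      using mult_left_mono[OF \<psi>01(2)[of x], of "2 * (v x)\<^sup>2"] by simp
    finally show ?thesis .
  qed
  then show "AE x in lebesgue. norm (\<bar>v x\<bar> powr p * \<psi> x) \<le> norm (2 * (\<bar>v x\<bar> * \<psi> x) + 2 * (v x)\<^sup>2)"
    using \<psi>01 by simp
qed (use v \<psi> in measurable)

text \<open>This continuity in time lets the nonlinear term be integrated and differentiated
  classically, and lets estimates known for almost every time be extended to every time.\<close>

lemma continuous_on_powr_weight: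
  assumes p: "1 < p" "p < 2" and w: "C0_in_time T L2_seminorm L2_space w"
    and \<psi>: "\<psi> \<in> L2_space" "\<And>x. 0 \<le> \<psi> x" "\<And>x. \<psi> x \<le> 1"
  shows "continuous_on {0..<T} (\<lambda>t. LINT x|lebesgue. \<bar>w (x, t)\<bar> powr p * \<psi> x)"
  unfolding continuous_on_def
proof
  fix t assume t: "t \<in> {0..<T}"
  let ?P = "\<lambda>s. LINT x|lebesgue. \<bar>w (x, s)\<bar> powr p * \<psi> x"
  let ?N = "\<lambda>s. L2_seminorm (\<lambda>x. w (x, s) - w (x, t))"
  let ?M = "L2_seminorm (\<lambda>x. w (x, t))"
  have slice: "(\<lambda>x. w (x, s)) \<in> L2_space" if "s \<in> {0..<T}" for s
    using w that by (rule C0_in_time_L2_slice)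
  have "((\<lambda>s. ?P s - ?P t) \<longlongrightarrow> 0) (at t within {0..<T})"
  proof (rule Lim_null_comparison)
    show "\<forall>\<^sub>F s in at t within {0..<T}. norm (?P s - ?P t)
        \<le> 2 * (?N s * L2_seminorm \<psi>) + 4 * (?N s * ?M) + 2 * (?N s)\<^sup>2"
      unfolding eventually_at_filter
    proof (rule always_eventually, intro allI impI)
      fix s assume s: "s \<in> {0..<T}"
      let ?e = "\<lambda>x. \<bar>w (x, s) - w (x, t)\<bar>"
      have e: "?e \<in> L2_space" by (intro L2_abs L2_diff slice s t)
      have nrm_e: "L2_seminorm ?e = ?N s" by (rule L2_seminorm_abs)
      have wt: "(\<lambda>x. \<bar>w (x, t)\<bar>) \<in> L2_space" by (intro L2_abs slice t)
      have int: "integrable lebesgue (\<lambda>x. \<bar>w (x, r)\<bar> powr p * \<psi> x)" if "r \<in> {0..<T}" for r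
        by (intro integrable_powr_weight p slice that \<psi>)
      have "norm (?P s - ?P t)
          = norm (LINT x|lebesgue. \<bar>w (x, s)\<bar> powr p * \<psi> x - \<bar>w (x, t)\<bar> powr p * \<psi> x)"
        using int[OF s] int[OF t] by simp
      also have "\<dots> \<le> (LINT x|lebesgue. 2 * (?e x * \<psi> x) + 4 * (?e x * \<bar>w (x, t)\<bar>) + 2 * (?e x)\<^sup>2)"
      proof (rule Bochner_Integration.integral_norm_bound_integral)
        show "integrable lebesgue (\<lambda>x. 2 * (?e x * \<psi> x) + 4 * (?e x * \<bar>w (x, t)\<bar>) + 2 * (?e x)\<^sup>2)"
          by (intro Bochner_Integration.integrable_add integrable_mult_right
              L2_mult_integrable L2_integrable_sq e wt \<psi>)
        show "norm (\<bar>w (x, s)\<bar> powr p * \<psi> x - \<bar>w (x, t)\<bar> powr p * \<psi> x)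
            \<le> 2 * (?e x * \<psi> x) + 4 * (?e x * \<bar>w (x, t)\<bar>) + 2 * (?e x)\<^sup>2" for x
        proof -
          have "norm (\<bar>w (x, s)\<bar> powr p * \<psi> x - \<bar>w (x, t)\<bar> powr p * \<psi> x)
              = \<bar>\<bar>w (x, s)\<bar> powr p - \<bar>w (x, t)\<bar> powr p\<bar> * \<psi> x"
            using \<psi>(2)[of x] by (simp add: left_diff_distrib[symmetric] abs_mult)
          also have "\<dots> \<le> 2 * (1 + \<bar>w (x, s)\<bar> + \<bar>w (x, t)\<bar>) * ?e x * \<psi> x"
            by (intro mult_right_mono abs_powr_diff_le p \<psi>)
          \<comment> \<open>The slice at \<open>s\<close> is replaced by the one at \<open>t\<close>
            plus the increment, so the final bound contains only the fixed norm \<open>?M\<close>,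
            the norm of \<open>\<psi>\<close> and the vanishing norm \<open>?N s\<close>.\<close>
          also have "\<dots> \<le> 2 * (1 + ?e x + 2 * \<bar>w (x, t)\<bar>) * ?e x * \<psi> x"
            using \<psi>(2)[of x] by (intro mult_right_mono mult_left_mono) auto
          also have "\<dots> = 2 * (?e x * \<psi> x) + (4 * (?e x * \<bar>w (x, t)\<bar>) + 2 * (?e x)\<^sup>2) * \<psi> x"
            by (simp only: power2_eq_square) (simp only: algebra_simps)
          also have "\<dots> \<le> 2 * (?e x * \<psi> x) + (4 * (?e x * \<bar>w (x, t)\<bar>) + 2 * (?e x)\<^sup>2)"
            by (intro add_left_mono mult_left_le \<psi>) auto
          finally show ?thesis by simp
        qed
      qed (use int[OF s] int[OF t] in simp)
      also have "\<dots> = 2 * (LINT x|lebesgue. ?e x * \<psi> x) + 4 * (LINT x|lebesgue. ?e x * \<bar>w (x, t)\<bar>)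
          + 2 * (LINT x|lebesgue. (?e x)\<^sup>2)"
        using L2_mult_integrable[OF e wt] L2_mult_integrable[OF e \<psi>(1)] L2_integrable_sq[OF e]
        by simp
      also have "\<dots> \<le> 2 * (?N s * L2_seminorm \<psi>) + 4 * (?N s * ?M) + 2 * (?N s)\<^sup>2"
        using L2_Cauchy_Schwarz[OF e \<psi>(1)] L2_Cauchy_Schwarz[OF e wt] L2_seminorm_real[of ?e]
        unfolding nrm_e L2_seminorm_abs by linarith
      finally show "norm (?P s - ?P t) \<le> 2 * (?N s * L2_seminorm \<psi>) + 4 * (?N s * ?M) + 2 * (?N s)\<^sup>2" .
    qed
    have "(?N \<longlongrightarrow> 0) (at t within {0..<T})" using w t by (simp add: C0_in_time_def)
    then have "((\<lambda>s. 2 * (?N s * L2_seminorm \<psi>) + 4 * (?N s * ?M) + 2 * (?N s)\<^sup>2)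
        \<longlongrightarrow> 2 * (0 * L2_seminorm \<psi>) + 4 * (0 * ?M) + 2 * 0\<^sup>2) (at t within {0..<T})"
      by (intro tendsto_intros)
    then show "((\<lambda>s. 2 * (?N s * L2_seminorm \<psi>) + 4 * (?N s * ?M) + 2 * (?N s)\<^sup>2)
        \<longlongrightarrow> 0) (at t within {0..<T})" by simp
  qed
  then show "(?P \<longlongrightarrow> ?P t) (at t within {0..<T})"
    by (rule Lim_null[THEN iffD2])
qed

text \<open>
  Hoelder's inequality, obtained by integrating the tangent line inequality for \<open>x powr p\<close> at the
  mean value of \<open>v\<close>.
\<close>

lemma integral_powr_ge:
  fixes v \<psi> :: "'a::euclidean_space \<Rightarrow> real"
  assumes p: "1 < p" and v: "v \<in> L2_space" and \<psi>: "\<psi> \<in> L2_space" "\<And>x. 0 \<le> \<psi> x"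
    and int: "integrable lebesgue (\<lambda>x. \<bar>v x\<bar> powr p * \<psi> x)"
    and B: "B \<in> sets lebesgue" "emeasure lebesgue B < \<infinity>" "measure lebesgue B \<le> M" "M > 0"
    and on: "\<And>x. x \<in> B \<Longrightarrow> \<psi> x = 1" and off: "AE x in lebesgue. x \<notin> B \<longrightarrow> v x = 0"
    and F: "F = (LINT x|lebesgue. v x * \<psi> x)" "F \<ge> 0"
  shows "M powr (1 - p) * F powr p \<le> (LINT x|lebesgue. \<bar>v x\<bar> powr p * \<psi> x)"
proof -
  define c where "c = F / M"
  have c: "c \<ge> 0" "F = M * c" using F B by (auto simp: c_def)
  have intB: "integrable lebesgue (\<lambda>x. indicator B x :: real)"
    using B by (simp add: integrable_indicator_iff)
  have "p * c powr (p - 1) * F - (p - 1) * c powr p * M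
      \<le> p * c powr (p - 1) * F - (p - 1) * c powr p * measure lebesgue B"
    using B(3) p by (intro diff_left_mono mult_left_mono) auto
  also have "\<dots> = (LINT x|lebesgue. p * c powr (p - 1) * (v x * \<psi> x) - (p - 1) * c powr p * indicator B x)"
    using intB L2_mult_integrable[OF v \<psi>(1)] B by (simp add: F(1))
  also have "\<dots> \<le> (LINT x|lebesgue. \<bar>v x\<bar> powr p * \<psi> x)"
  proof (rule integral_mono_AE)
    show "AE x in lebesgue. p * c powr (p - 1) * (v x * \<psi> x) - (p - 1) * c powr p * indicator B x
        \<le> \<bar>v x\<bar> powr p * \<psi> x"
      using off
    proof (rule AE_mp, intro AE_I2 impI)
      fix x assume x: "x \<notin> B \<longrightarrow> v x = 0"
      have "p * c powr (p - 1) * v x \<le> p * c powr (p - 1) * \<bar>v x\<bar>"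
        using p by (intro mult_left_mono) auto
      then have "p * c powr (p - 1) * v x - (p - 1) * c powr p \<le> \<bar>v x\<bar> powr p"
        using powr_above_tangent[OF p abs_ge_zero c(1), of "v x"] by linarith
      with x show "p * c powr (p - 1) * (v x * \<psi> x) - (p - 1) * c powr p * indicator B x
          \<le> \<bar>v x\<bar> powr p * \<psi> x"
        by (cases "x \<in> B") (auto simp: on)
    qed
  qed (use int intB L2_mult_integrable[OF v \<psi>(1)] in auto)
  finally have le: "p * c powr (p - 1) * F - (p - 1) * c powr p * M
      \<le> (LINT x|lebesgue. \<bar>v x\<bar> powr p * \<psi> x)" .
  \<comment> \<open>At the mean value \<open>c\<close> the two terms of the tangent bound are
    \<open>p\<close> and \<open>p - 1\<close> times \<open>M * c powr p\<close>, so exactly one copy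
    remains.\<close>
  have "c powr p = c * c powr (p - 1)"
    using powr_mult_base[OF c(1), of "p - 1"] by simp
  then have "p * c powr (p - 1) * F - (p - 1) * c powr p * M = M * c powr p"
    by (simp add: c(2) algebra_simps)
  also have "\<dots> = M powr (1 - p) * F powr p"
    using B F by (simp add: c_def powr_divide powr_diff)
  finally show ?thesis using le by simp
qed

section \<open>Test functions\<close>

lemma Cc_infinity_zero_outside:
  assumes "\<phi> \<in> Cc_infinity S"
  obtains r where "r > 0" "\<And>x. norm x > r \<Longrightarrow> \<phi> x = 0"
proof -
  have "bounded (closure {x. \<phi> x \<noteq> 0})"
    using assms by (simp add: Cc_infinity_def compact_imp_bounded)
  then obtain r where "r > 0" "\<And>x. x \<in> closure {x. \<phi> x \<noteq> 0} \<Longrightarrow> norm x \<le> r"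
    by (auto simp: bounded_pos)
  then show ?thesis using that closure_subset[of "{x. \<phi> x \<noteq> 0}"]
    by (metis (mono_tags, lifting) mem_Collect_eq not_less subsetD)
qed

lemma Cc_infinity_continuous: "\<phi> \<in> Cc_infinity S \<Longrightarrow> continuous_on UNIV \<phi>"
  unfolding Cc_infinity_def smooth_def using Ck.simps(1) by blast

lemma Cc_infinity_L2:
  fixes \<phi> :: "'a::euclidean_space \<Rightarrow> real"
  assumes "\<phi> \<in> Cc_infinity S"
  shows "\<phi> \<in> L2_space"
proof -
  have cont: "continuous_on UNIV \<phi>" using assms by (rule Cc_infinity_continuous)
  obtain r where r: "\<And>x. norm x > r \<Longrightarrow> \<phi> x = 0"
    using Cc_infinity_zero_outside[OF assms] by blast
  have "integrable lborel (\<lambda>x. indicator (cball 0 r) x *\<^sub>R (\<phi> x)\<^sup>2)"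
    by (intro borel_integrable_compact continuous_intros continuous_on_subset[OF cont]) auto
  also have "(\<lambda>x. indicator (cball 0 r) x *\<^sub>R (\<phi> x)\<^sup>2) = (\<lambda>x. (\<phi> x)\<^sup>2)"
    using r by (force simp: indicator_def)
  finally have "integrable lborel (\<lambda>x. (\<phi> x)\<^sup>2)" .
  moreover have "\<phi> \<in> borel_measurable lborel"
    using cont by (simp add: borel_measurable_continuous_onI)
  ultimately show ?thesis
    by (simp add: L2_space_def integrable_completion measurable_completion)
qed

lemma frechet_derivative_locally_const:
  assumes "open U" "x \<in> U" "\<And>y. y \<in> U \<Longrightarrow> \<phi> y = c"
  shows "frechet_derivative \<phi> (at x) = (\<lambda>_. 0)"
proof -
  have "(\<phi> has_derivative (\<lambda>_. 0)) (at x)"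
    by (rule has_derivative_transform_within_open[OF has_derivative_const assms(1,2)])
      (simp add: assms(3))
  then show ?thesis by (rule frechet_derivative_at[symmetric])
qed

text \<open>Off its closed support a function vanishes on a whole neighbourhood, hence so does its
  derivative. Partial derivatives of a cutoff can therefore serve as test functions for the weak
  gradient.\<close>

lemma Cc_infinity_partial_derivative:
  assumes \<phi>: "\<phi> \<in> Cc_infinity S" and b: "b \<in> Basis"
  shows "(\<lambda>x. frechet_derivative \<phi> (at x) b) \<in> Cc_infinity S"
proof -
  let ?K = "closure {x. \<phi> x \<noteq> 0}"
  have "frechet_derivative \<phi> (at x) b = 0" if "x \<notin> ?K" for x
  proof -
    have "frechet_derivative \<phi> (at x) = (\<lambda>_. 0)"
      by (rule frechet_derivative_locally_const[of "- ?K"])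
        (use that closure_subset[of "{x. \<phi> x \<noteq> 0}"] in auto)
    then show ?thesis by simp
  qed
  then have "{x. frechet_derivative \<phi> (at x) b \<noteq> 0} \<subseteq> ?K" by blast
  then have sub: "closure {x. frechet_derivative \<phi> (at x) b \<noteq> 0} \<subseteq> ?K"
    by (simp add: closure_minimal)
  moreover have "compact (closure {x. frechet_derivative \<phi> (at x) b \<noteq> 0})"
    using compact_Int_closed[of ?K, OF _ closed_closure] sub \<phi>
    by (metis (mono_tags, lifting) Cc_infinity_def inf.absorb2 mem_Collect_eq)
  moreover have "smooth (\<lambda>x. frechet_derivative \<phi> (at x) b)"
    unfolding smooth_def
  proof
    fix k
    have "Ck (Suc k) \<phi>" using \<phi> by (auto simp: Cc_infinity_def smooth_def)
    with b show "Ck k (\<lambda>x. frechet_derivative \<phi> (at x) b)" by simp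
  qed
  ultimately show ?thesis using \<phi> by (auto simp: Cc_infinity_def)
qed

lemma Cc_infinityI:
  assumes "smooth \<phi>" "compact K" "K \<subseteq> S" "\<And>x. \<phi> x \<noteq> 0 \<Longrightarrow> x \<in> K"
  shows "\<phi> \<in> Cc_infinity S"
proof -
  have sub: "closure {x. \<phi> x \<noteq> 0} \<subseteq> K"
    using assms by (intro closure_minimal) (auto simp: compact_imp_closed)
  then have "compact (closure {x. \<phi> x \<noteq> 0})"
    using compact_Int_closed[OF assms(2) closed_closure[of "{x. \<phi> x \<noteq> 0}"]]
    by (simp add: inf.absorb2)
  then show ?thesis using sub assms by (auto simp: Cc_infinity_def)
qed

section \<open>Cutoffs in space and time\<close>

lemma ex_space_cutoff:
  fixes \<rho> :: real
  assumes "\<rho> > 0"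
  obtains \<zeta> :: "'a::euclidean_space \<Rightarrow> real"
  where "\<zeta> \<in> Cc_infinity UNIV" "smooth (\<lambda>z::'a \<times> real. \<zeta> (fst z))"
    "\<And>x. 0 \<le> \<zeta> x" "\<And>x. \<zeta> x \<le> 1" "\<And>x. norm x \<le> \<rho> \<Longrightarrow> \<zeta> x = 1" "\<And>x. norm x \<ge> \<rho> + 1 \<Longrightarrow> \<zeta> x = 0"
proof -
  obtain H :: "real \<Rightarrow> real" where H: "smooth H" "\<And>y. y \<le> 0 \<Longrightarrow> H y = 0" "\<And>y. y \<ge> 1 \<Longrightarrow> H y = 1"
    "\<And>y. 0 \<le> H y" "\<And>y. H y \<le> 1"
    using ex_smooth_step by auto
  have CkH: "Ck k H" for k using H(1) by (simp add: smooth_def)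
  \<comment> \<open>The argument of the step is at least \<open>1\<close> exactly on the ball of
    radius \<open>\<rho>\<close>. It is nonpositive once the norm reaches \<open>\<rho> + 1\<close>,
    because \<open>(\<rho> + 1)\<^sup>2\<close> is at least
    \<open>\<rho>\<^sup>2 + 1\<close>.\<close>
  define \<zeta> :: "'a \<Rightarrow> real" where "\<zeta> x = H ((\<rho>\<^sup>2 + 1) + (-1) * (x \<bullet> x))" for x
  have "smooth \<zeta>"
    unfolding smooth_def \<zeta>_def
    by (intro allI Ck_compose[OF CkH] Ck_add Ck_mult Ck_const Ck_inner_self bounded_linear_ident)
  moreover have "smooth (\<lambda>z::'a \<times> real. \<zeta> (fst z))"
    unfolding smooth_def \<zeta>_def
    by (intro allI Ck_compose[OF CkH] Ck_add Ck_mult Ck_const Ck_inner_self bounded_linear_fst)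
  moreover have one: "\<zeta> x = 1" if "norm x \<le> \<rho>" for x
  proof -
    have "x \<bullet> x \<le> \<rho>\<^sup>2" using that power_mono[of "norm x" \<rho> 2] by (simp add: power2_norm_eq_inner)
    then show ?thesis by (simp add: \<zeta>_def H(3))
  qed
  moreover have zero: "\<zeta> x = 0" if "norm x \<ge> \<rho> + 1" for x
  proof -
    have "\<rho>\<^sup>2 + 1 \<le> (\<rho> + 1)\<^sup>2" using assms by (simp add: power2_eq_square algebra_simps)
    also have "\<dots> \<le> x \<bullet> x" using that assms power_mono[of "\<rho> + 1" "norm x" 2]
      by (simp add: power2_norm_eq_inner)
    finally show ?thesis by (simp add: \<zeta>_def H(2))
  qed
  moreover have "\<zeta> \<in> Cc_infinity UNIV"
  proof (rule Cc_infinityI[OF \<open>smooth \<zeta>\<close> compact_cball[of 0 "\<rho> + 1"]])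
    show "x \<in> cball 0 (\<rho> + 1)" if "\<zeta> x \<noteq> 0" for x
      using that zero[of x] by (cases "\<rho> + 1 \<le> norm x") auto
  qed simp
  ultimately show ?thesis using that H(4,5) by (simp add: \<zeta>_def)
qed

lemma ex_time_cutoff:
  fixes t T :: real
  assumes "0 \<le> t" "t < T"
  obtains \<eta> :: "real \<Rightarrow> real" and \<delta> where "smooth (\<lambda>z::'a::euclidean_space \<times> real. \<eta> (snd z))"
    "\<delta> > 0" "t + 2 * \<delta> < T" "\<And>s. - \<delta> \<le> s \<Longrightarrow> s \<le> t + \<delta> \<Longrightarrow> \<eta> s = 1"
    "\<And>s. \<eta> s \<noteq> 0 \<Longrightarrow> s \<in> {- 2 * \<delta>..t + 2 * \<delta>}"
proof -
  obtain H :: "real \<Rightarrow> real" where H: "smooth H" "\<And>y. y \<le> 0 \<Longrightarrow> H y = 0" "\<And>y. y \<ge> 1 \<Longrightarrow> H y = 1"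
    using ex_smooth_step by auto
  have CkH: "Ck k H" for k using H(1) by (simp add: smooth_def)
  define \<delta> where "\<delta> = (T - t) / 3"
  have \<delta>: "\<delta> > 0" "t + 2 * \<delta> < T" using assms by (auto simp: \<delta>_def field_simps)
  \<comment> \<open>The first factor switches on between \<open>- 2 * \<delta>\<close> and
    \<open>- \<delta>\<close>, the second switches off between \<open>t + \<delta>\<close> and
    \<open>t + 2 * \<delta>\<close>.\<close>
  define \<eta> where "\<eta> s = H (2 + (1 / \<delta>) * s) * H ((t / \<delta> + 2) + (- 1 / \<delta>) * s)" for s
  have "smooth (\<lambda>z::'a \<times> real. \<eta> (snd z))"
    unfolding smooth_def \<eta>_def
    by (intro allI Ck_mult Ck_compose[OF CkH] Ck_add Ck_const Ck_bounded_linear bounded_linear_snd)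
  moreover have "\<eta> s = 1" if "- \<delta> \<le> s" "s \<le> t + \<delta>" for s
  proof -
    have "- 1 \<le> s / \<delta>" "(s - t) / \<delta> \<le> 1"
      using that \<delta> by (simp_all add: pos_le_divide_eq pos_divide_le_eq)
    then have "2 + (1 / \<delta>) * s \<ge> 1" "(t / \<delta> + 2) + (- 1 / \<delta>) * s \<ge> 1"
      by (simp_all add: diff_divide_distrib)
    then show ?thesis by (simp only: \<eta>_def H(3) mult_1)
  qed
  moreover have "s \<in> {- 2 * \<delta>..t + 2 * \<delta>}" if "\<eta> s \<noteq> 0" for s
  proof (rule ccontr)
    assume "s \<notin> {- 2 * \<delta>..t + 2 * \<delta>}"
    then have "s / \<delta> \<le> - 2 \<or> 2 \<le> (s - t) / \<delta>"
      using \<delta> by (auto simp: pos_le_divide_eq pos_divide_le_eq)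
    then consider "2 + (1 / \<delta>) * s \<le> 0" | "(t / \<delta> + 2) + (- 1 / \<delta>) * s \<le> 0"
      by (auto simp: diff_divide_distrib)
    then show False using that by cases (simp_all only: \<eta>_def H(2) mult_zero_left mult_zero_right)
  qed
  ultimately show ?thesis using that \<delta> by blast
qed

text \<open>A function of space alone has no compact support in time. The product with a time cutoff
  repairs this, and since that cutoff is \<open>1\<close> on a neighbourhood of
  \<open>[0,t]\<close>, derivatives at the end points \<open>0\<close> and \<open>t\<close> are not
  affected either.\<close>

lemma ex_test_function:
  fixes \<zeta> :: "'a::euclidean_space \<Rightarrow> real"
  assumes t: "0 \<le> t" "t < T" and \<zeta>: "\<zeta> \<in> Cc_infinity UNIV" "smooth (\<lambda>z::'a \<times> real. \<zeta> (fst z))"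
  obtains \<phi> where "\<phi> \<in> Cc_infinity (UNIV \<times> {..<T})"
    "\<And>x s. s \<in> {0..t} \<Longrightarrow> \<phi> (x, s) = \<zeta> x"
    "\<And>x s. s \<in> {0..t} \<Longrightarrow> time_derivative \<phi> (x, s) = 0"
    "\<And>x s. s \<in> {0..t} \<Longrightarrow> space_gradient \<phi> (x, s) = (\<Sum>b\<in>Basis. frechet_derivative \<zeta> (at x) b *\<^sub>R b)"
proof -
  obtain \<eta> :: "real \<Rightarrow> real" and \<delta> where \<eta>: "smooth (\<lambda>z::'a \<times> real. \<eta> (snd z))"
    "\<delta> > 0" "t + 2 * \<delta> < T" "\<And>s. - \<delta> \<le> s \<Longrightarrow> s \<le> t + \<delta> \<Longrightarrow> \<eta> s = 1"
    "\<And>s. \<eta> s \<noteq> 0 \<Longrightarrow> s \<in> {- 2 * \<delta>..t + 2 * \<delta>}"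
    using ex_time_cutoff[OF t] by metis
  define \<phi> where "\<phi> z = \<zeta> (fst z) * \<eta> (snd z)" for z
  obtain r where r: "\<And>x. norm x > r \<Longrightarrow> \<zeta> x = 0"
    using Cc_infinity_zero_outside[OF \<zeta>(1)] by blast
  have "\<phi> \<in> Cc_infinity (UNIV \<times> {..<T})"
  proof (rule Cc_infinityI)
    show "smooth \<phi>" using \<zeta>(2) \<eta>(1) unfolding smooth_def \<phi>_def by (intro allI Ck_mult) auto
    show "compact (cball 0 r \<times> {- 2 * \<delta>..t + 2 * \<delta>} :: ('a \<times> real) set)" by (intro compact_Times) auto
    show "z \<in> cball 0 r \<times> {- 2 * \<delta>..t + 2 * \<delta>}" if "\<phi> z \<noteq> 0" for z
      using that r[of "fst z"] \<eta>(5)[of "snd z"] by (cases z) (auto simp: \<phi>_def not_less[symmetric])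
  qed (use \<eta>(3) in auto)
  moreover have "\<phi> (x, s) = \<zeta> x" if "s \<in> {0..t}" for x s
    using that \<eta>(2,4) by (simp add: \<phi>_def)
  moreover have D: "frechet_derivative \<phi> (at (x, s)) (h, k) = frechet_derivative \<zeta> (at x) h"
    if s: "s \<in> {0..t}" for x s h k
  proof -
    have "(\<zeta> has_derivative frechet_derivative \<zeta> (at x)) (at x)"
      using \<zeta>(1) unfolding Cc_infinity_def smooth_def by (blast intro: Ck_has_derivative)
    then have "((\<lambda>z. \<zeta> (fst z)) has_derivative (\<lambda>v. frechet_derivative \<zeta> (at x) (fst v))) (at (x, s))"
      using has_derivative_compose[OF has_derivative_fst[OF has_derivative_ident, of "at (x, s)"], of \<zeta>]
      by simp
    then have "(\<phi> has_derivative (\<lambda>v. frechet_derivative \<zeta> (at x) (fst v))) (at (x, s))"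
      by (rule has_derivative_transform_within_open[where s="UNIV \<times> {- \<delta><..<t + \<delta>}"])
        (use s \<eta>(2,4) in \<open>auto simp: \<phi>_def open_Times\<close>)
    then show ?thesis by (simp add: frechet_derivative_at[symmetric])
  qed
  moreover have "frechet_derivative \<zeta> (at x) 0 = 0" for x
  proof -
    have "Ck (Suc 0) \<zeta>" using \<zeta>(1) by (auto simp: Cc_infinity_def smooth_def)
    from linear_0[OF has_derivative_linear[OF Ck_has_derivative[OF this]]] show ?thesis .
  qed
  ultimately show ?thesis
    using that by (simp add: time_derivative_def space_gradient_def)
qed

text \<open>Moving the gradient in the weak formulation onto the cutoff, which is locally constant on the support of \<open>v\<close>.\<close>

lemma weak_gradient_cutoff_integral:
  fixes v \<zeta> :: "'a::euclidean_space \<Rightarrow> real"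
  assumes v: "v \<in> H1_space" and \<zeta>: "\<zeta> \<in> Cc_infinity UNIV" and U: "open U"
    and one: "\<And>x. x \<in> U \<Longrightarrow> \<zeta> x = 1" and off: "AE x in lebesgue. x \<notin> U \<longrightarrow> v x = 0"
  shows "(LINT x|lebesgue. weak_gradient v x \<bullet> (\<Sum>b\<in>Basis. frechet_derivative \<zeta> (at x) b *\<^sub>R b)) = 0"
proof -
  have "weak_gradient v \<in> L2_space \<and> is_weak_gradient v (weak_gradient v)"
    using v someI_ex[of "\<lambda>G. G \<in> L2_space \<and> is_weak_gradient v G"]
    by (auto simp: weak_gradient_def H1_space_def)
  then have G: "weak_gradient v \<in> L2_space" "is_weak_gradient v (weak_gradient v)" by auto
  have L2: "(\<lambda>x. frechet_derivative \<zeta> (at x) b) \<in> L2_space" if "b \<in> Basis" for b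
    using Cc_infinity_partial_derivative[OF \<zeta> that] by (rule Cc_infinity_L2)
  have "(LINT x|lebesgue. weak_gradient v x \<bullet> (\<Sum>b\<in>Basis. frechet_derivative \<zeta> (at x) b *\<^sub>R b))
      = (LINT x|lebesgue. (\<Sum>b\<in>Basis. (weak_gradient v x \<bullet> b) * frechet_derivative \<zeta> (at x) b))"
    by (simp add: inner_sum_right mult.commute)
  also have "\<dots> = (\<Sum>b\<in>Basis. LINT x|lebesgue. (weak_gradient v x \<bullet> b) * frechet_derivative \<zeta> (at x) b)"
    using G L2 by (intro Bochner_Integration.integral_sum L2_mult_integrable L2_inner_right)
  also have "\<dots> = 0"
  proof (rule sum.neutral, intro ballI)
    fix b :: 'a assume b: "b \<in> Basis"
    let ?\<zeta> = "\<lambda>x. frechet_derivative \<zeta> (at x) b"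
    \<comment> \<open>After one more integration by parts \<open>v\<close> meets a second derivative
      of the cutoff: the latter vanishes on \<open>U\<close>, the former almost everywhere off
      \<open>U\<close>.\<close>
    have "frechet_derivative ?\<zeta> (at x) b = 0" if "x \<in> U" for x
    proof -
      have "frechet_derivative ?\<zeta> (at x) = (\<lambda>_. 0)"
        using frechet_derivative_locally_const[OF U _ one] U that
        by (intro frechet_derivative_locally_const[where U=U and c=0]) auto
      then show ?thesis by simp
    qed
    then have "AE x in lebesgue. v x * frechet_derivative ?\<zeta> (at x) b = 0"
      using off by (auto elim!: eventually_mono)
    then have "(LINT x|lebesgue. v x * frechet_derivative ?\<zeta> (at x) b) = 0"
      by (rule integral_eq_zero_AE)
    then show "(LINT x|lebesgue. (weak_gradient v x \<bullet> b) * frechet_derivative \<zeta> (at x) b) = 0"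
      using G(2) Cc_infinity_partial_derivative[OF \<zeta> b] b by (simp add: is_weak_gradient_def)
  qed
  finally show ?thesis .
qed

section \<open>The support condition on time slices\<close>

text \<open>The complement of the support is a union of possibly uncountably many open sets on which
  \<open>f\<close> vanishes almost everywhere. By Lindelof's theorem countably many of them suffice,
  and countable unions preserve null sets.\<close>

lemma AE_outside_ess_support:
  "AE z in lebesgue. z \<in> S \<longrightarrow> z \<notin> ess_support S f \<longrightarrow> f z = 0"
proof -
  let ?F = "{W. open W \<and> (AE y in lebesgue. y \<in> W \<inter> S \<longrightarrow> f y = 0)}"
  obtain F' where F': "F' \<subseteq> ?F" "countable F'" "\<Union>F' = \<Union>?F"
    using Lindelof[of ?F] by blast
  have "AE y in lebesgue. \<forall>W\<in>F'. y \<in> W \<inter> S \<longrightarrow> f y = 0"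
    using F'(1) by (subst AE_ball_countable[OF F'(2)]) auto
  then show ?thesis
  proof (rule AE_mp, intro AE_I2 impI)
    fix z assume z: "\<forall>W\<in>F'. z \<in> W \<inter> S \<longrightarrow> f z = 0" "z \<in> S" "z \<notin> ess_support S f"
    then have "z \<in> \<Union>?F" by (auto simp: ess_support_def)
    with F'(3) z show "f z = 0" by blast
  qed
qed

text \<open>Fubini's theorem for a Borel null set covering the exceptional points. It controls only
  almost every time slice; the remaining times are recovered by continuity where they
  matter.\<close>

lemma AE_lebesgue_time_slices:
  fixes Q :: "'a::euclidean_space \<times> 'b::euclidean_space \<Rightarrow> bool"
  assumes "AE z in lebesgue. Q z"
  shows "AE t in lebesgue. AE x in lebesgue. Q (x, t)"
proof -
  have "AE z in lborel \<Otimes>\<^sub>M lborel. Q z"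
    using assms by (subst lborel_prod) (simp add: AE_completion_iff)
  then obtain N where "\<And>z. z \<in> space (lborel \<Otimes>\<^sub>M lborel) - N \<Longrightarrow> Q z"
    and N: "N \<in> null_sets (lborel \<Otimes>\<^sub>M lborel)"
    by (rule AE_E3) blast
  then have Q: "\<And>z. z \<notin> N \<Longrightarrow> Q z" by (simp add: space_pair_measure)
  have "AE z in lborel \<Otimes>\<^sub>M lborel. z \<notin> N" using N by (rule AE_not_in)
  then have "AE x in lborel. AE t in lborel. (x, t) \<notin> N"
    by (rule lborel_pair.AE_pair)
  then have "AE t in lborel. AE x in lborel. (x, t) \<notin> N"
  proof (subst (asm) lborel_pair.AE_commute)
    let ?M = "lborel \<Otimes>\<^sub>M lborel :: ('a \<times> 'b) measure"
    have "{x \<in> space ?M. (fst x, snd x) \<notin> N} = space ?M - N" by auto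
    also have "\<dots> \<in> sets ?M" using N by (intro sets.compl_sets null_setsD2)
    finally show "{x \<in> space ?M. (fst x, snd x) \<notin> N} \<in> sets ?M" .
  qed
  then have "AE t in lborel. AE x in lborel. Q (x, t)"
    by eventually_elim (use Q in \<open>auto elim!: eventually_mono\<close>)
  then show ?thesis by (simp add: AE_completion_iff)
qed

section \<open>Blow-up of the integral inequality\<close>

text \<open>
  The hypotheses on \<open>\<kappa>\<close> and \<open>\<gamma>\<close> make \<open>\<kappa> (b - t) powr - \<gamma>\<close> a solution of
  \<open>v'' = K v powr p\<close> which blows up at \<open>b\<close>. It stays below \<open>F\<close>, contradicting the continuity
  of \<open>F\<close> at \<open>b\<close>.
\<close>

lemma blowup_comparison:
  fixes F y :: "real \<Rightarrow> real"
  assumes ab: "a < b" and p: "p > 1" and \<gamma>: "\<gamma> = 2 / (p - 1)" and \<kappa>: "\<kappa> > 0"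
    and K: "K * \<kappa> powr (p - 1) = \<gamma> * (\<gamma> + 1)"
    and F': "\<And>t. t \<in> {a..b} \<Longrightarrow> (F has_real_derivative y t) (at t within {a..b})"
    and y: "\<And>t. t \<in> {a..b} \<Longrightarrow> y t \<ge> A + K * integral {a..t} (\<lambda>s. F s powr p)"
    and Fa: "F a > \<kappa> * (b - a) powr - \<gamma>"
    and A: "A \<ge> \<kappa> * \<gamma> * (b - a) powr (- \<gamma> - 1)"
  shows False
proof -
  define v where "v t = \<kappa> * (b - t) powr - \<gamma>" for t
  define v' where "v' t = \<kappa> * \<gamma> * (b - t) powr (- \<gamma> - 1)" for t
  have \<gamma>0: "\<gamma> > 0" using p \<gamma> by simp
  \<comment> \<open>This balance of exponents fixes \<open>\<gamma>\<close>: two derivatives of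
    \<open>v\<close> and its \<open>p\<close>-th power have the same singularity at
    \<open>b\<close>.\<close>
  have \<gamma>p: "- \<gamma> * p = - \<gamma> - 2" using p by (simp add: \<gamma> field_simps)
  have K0: "K > 0"
  proof (rule ccontr)
    assume "\<not> K > 0"
    then have "K * \<kappa> powr (p - 1) \<le> 0" by (intro mult_nonpos_nonneg) auto
    with K \<gamma>0 show False by (simp add: mult_le_0_iff)
  qed
  have dpow: "((\<lambda>t. (b - t) powr r) has_real_derivative - r * (b - t) powr (r - 1)) (at t)"
    if "t < b" for t r
    using that by (auto intro!: derivative_eq_intros simp: powr_diff)
  have dv: "(v has_real_derivative v' t) (at t)" if "t < b" for t
    using DERIV_cmult[OF dpow[OF that, of "- \<gamma>"], of \<kappa>] by (simp add: v_def[abs_def] v'_def mult.assoc)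
  have vp: "K * v t powr p = \<kappa> * \<gamma> * (\<gamma> + 1) * (b - t) powr (- \<gamma> - 2)" if "t < b" for t
  proof -
    have "v t powr p = \<kappa> powr p * (b - t) powr (- \<gamma> - 2)"
      using \<kappa> by (simp add: v_def powr_mult powr_powr \<gamma>p[symmetric])
    moreover have "\<kappa> powr p = \<kappa> * \<kappa> powr (p - 1)"
      using powr_mult_base[of \<kappa> "p - 1"] \<kappa> by simp
    ultimately have "K * v t powr p = \<kappa> * (K * \<kappa> powr (p - 1)) * (b - t) powr (- \<gamma> - 2)"
      by simp
    then show ?thesis by (simp add: K)
  qed
  have dv': "(v' has_real_derivative K * v t powr p) (at t)" if "t < b" for t
  proof -
    have "(v' has_real_derivative \<kappa> * \<gamma> * (- (- \<gamma> - 1) * (b - t) powr (- \<gamma> - 1 - 1))) (at t)"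
      unfolding v'_def by (intro DERIV_cmult dpow that)
    also have "\<kappa> * \<gamma> * (- (- \<gamma> - 1) * (b - t) powr (- \<gamma> - 1 - 1)) = K * v t powr p"
    proof -
      have "- \<gamma> - 1 - 1 = - \<gamma> - 2" "- (- \<gamma> - 1) = \<gamma> + 1" by simp_all
      then show ?thesis unfolding vp[OF that] by (simp only: mult.assoc)
    qed
    finally show ?thesis .
  qed
  have contF: "continuous_on {a..b} F"
    by (rule DERIV_continuous_on[where D=y]) (rule F')
  have contv: "continuous_on {a..t} v" if "t < b" for t
  proof (intro continuous_at_imp_continuous_on ballI)
    fix s assume "s \<in> {a..t}"
    with that have "(v has_real_derivative v' s) (at s)" by (intro dv) auto
    then show "isCont v s" by (rule DERIV_isCont)
  qed
  have int_v: "K * integral {a..t} (\<lambda>s. v s powr p) = v' t - v' a" "(\<lambda>s. v s powr p) integrable_on {a..t}"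
    if "a \<le> t" "t < b" for t
  proof -
    have "((\<lambda>s. K * v s powr p) has_integral v' t - v' a) {a..t}"
    proof (rule fundamental_theorem_of_calculus[OF that(1)])
      fix s assume "s \<in> {a..t}"
      then have "(v' has_real_derivative K * v s powr p) (at s)" using that by (intro dv') auto
      then show "(v' has_vector_derivative K * v s powr p) (at s within {a..t})"
        unfolding has_real_derivative_iff_has_vector_derivative
        by (rule has_vector_derivative_at_within)
    qed
    then show "K * integral {a..t} (\<lambda>s. v s powr p) = v' t - v' a"
      and "(\<lambda>s. v s powr p) integrable_on {a..t}"
      using K0 by (auto dest: integral_unique has_integral_integrable)
  qed
  \<comment> \<open>As long as \<open>F\<close> exceeds \<open>v\<close>, the integral inequality
    gives \<open>y\<close> at least \<open>v'\<close>, so \<open>F - v\<close> does not decrease and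
    keeps its strictly positive initial value.\<close>
  have step: "F t > v t" if t: "a \<le> t" "t < b" and below: "\<And>s. a \<le> s \<Longrightarrow> s < t \<Longrightarrow> F s > v s" for t
  proof (cases "a = t")
    case True
    then show ?thesis using Fa by (simp add: v_def)
  next
    case False
    have "(\<lambda>s. F s - v s) a \<le> (\<lambda>s. F s - v s) t"
    proof (rule DERIV_nonneg_imp_increasing_open[OF t(1)])
      fix s assume s: "a < s" "s < t"
      have "(F has_real_derivative y s) (at s)"
        using F'[of s] s t by (simp add: at_within_Icc_at)
      then have "((\<lambda>s. F s - v s) has_real_derivative y s - v' s) (at s)"
        using dv s t by (intro DERIV_diff) auto
      moreover have "y s \<ge> v' s"
      proof -
        have "integral {a..s} (\<lambda>s. v s powr p) \<le> integral {a..s} (\<lambda>s. F s powr p)"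
        proof (rule integral_le)
          have "continuous_on {a..s} F"
            using contF s t by (auto intro: continuous_on_subset)
          moreover have "F r > 0" if "r \<in> {a..s}" for r
          proof -
            have "v r > 0" using that s t \<kappa> by (simp add: v_def)
            with below[of r] that s show ?thesis by simp
          qed
          ultimately show "(\<lambda>s. F s powr p) integrable_on {a..s}"
            by (intro integrable_continuous_real continuous_on_powr' continuous_on_const)
              (use p in \<open>auto intro: less_imp_le\<close>)
        next
          fix r assume "r \<in> {a..s}"
          with below[of r] s \<kappa> p show "v r powr p \<le> F r powr p"
            by (intro powr_mono2) (auto simp: v_def)
        qed (use int_v s t in auto)
        then have "K * integral {a..s} (\<lambda>s. F s powr p) \<ge> v' s - v' a"
          using int_v(1)[of s] K0 s t by (simp flip: int_v(1))
        moreover have "A \<ge> v' a" using A by (simp add: v'_def)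
        ultimately show ?thesis using y[of s] s t by simp
      qed
      ultimately show "\<exists>d. ((\<lambda>s. F s - v s) has_real_derivative d) (at s) \<and> d \<ge> 0" by force
    next
      have "continuous_on {a..t} F"
        using contF t by (auto intro: continuous_on_subset)
      with contv[OF t(2)] show "continuous_on {a..t} (\<lambda>s. F s - v s)" by (intro continuous_intros)
    qed
    with Fa show ?thesis by (simp add: v_def)
  qed
  have above: "F t > v t" if "a \<le> t" "t < b" for t
  proof (rule ccontr)
    assume neg: "\<not> F t > v t"
    \<comment> \<open>The infimum of this closed set is the first time at which the comparison would
      fail, which \<open>step\<close> excludes.\<close>
    let ?Z = "{s \<in> {a..t}. F s - v s \<le> 0}"
    have "continuous_on {a..t} (\<lambda>s. F s - v s)"
    proof (intro continuous_intros contv that)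
      show "continuous_on {a..t} F"
        using contF that by (auto intro: continuous_on_subset)
    qed
    then have "closed ({a..t} \<inter> (\<lambda>s. F s - v s) -` {..0})"
      by (intro continuous_closed_preimage) auto
    also have "{a..t} \<inter> (\<lambda>s. F s - v s) -` {..0} = ?Z" by auto
    finally have "closed ?Z" .
    moreover have "?Z \<noteq> {}" using neg that by (auto intro!: exI[of _ t])
    moreover have bdd: "bdd_below ?Z" by (rule bdd_belowI[of _ a]) auto
    ultimately have m: "Inf ?Z \<in> ?Z" by (intro closed_contains_Inf)
    have "F (Inf ?Z) > v (Inf ?Z)"
    proof (rule step)
      fix s assume s: "a \<le> s" "s < Inf ?Z"
      show "F s > v s"
      proof (rule ccontr)
        assume "\<not> F s > v s"
        then have "s \<in> ?Z" using s m by auto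
        then have "Inf ?Z \<le> s" using bdd by (rule cInf_lower)
        with s show False by simp
      qed
    qed (use m that in auto)
    with m show False by simp
  qed
  have "(F \<longlongrightarrow> F b) (at_left b)"
    using contF ab by (rule continuous_on_Icc_at_leftD)
  \<comment> \<open>Multiplying by this factor turns the lower bound \<open>v\<close> into the
    constant \<open>\<kappa>\<close>, while \<open>F\<close> is bounded near \<open>b\<close>, so
    the product also tends to \<open>0\<close>.\<close>
  moreover have "((\<lambda>t. (b - t) powr \<gamma>) \<longlongrightarrow> 0) (at_left b)"
  proof (rule tendsto_zero_powrI)
    show "((\<lambda>t. b - t) \<longlongrightarrow> 0) (at_left b)" by (auto intro!: tendsto_eq_intros)
    show "\<forall>\<^sub>F t in at_left b. 0 \<le> b - t" by (simp add: eventually_at_filter)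
  qed (use \<gamma>0 in auto)
  ultimately have lim: "((\<lambda>t. F t * (b - t) powr \<gamma>) \<longlongrightarrow> F b * 0) (at_left b)"
    by (rule tendsto_mult)
  have "\<forall>\<^sub>F t in at_left b. \<kappa> \<le> F t * (b - t) powr \<gamma>"
    using eventually_at_left_real[OF ab]
  proof eventually_elim
    fix t assume t: "t \<in> {a<..<b}"
    then have "\<kappa> * (b - t) powr - \<gamma> * (b - t) powr \<gamma> \<le> F t * (b - t) powr \<gamma>"
      using above[of t] by (intro mult_right_mono) (auto simp: v_def)
    also have "\<kappa> * (b - t) powr - \<gamma> * (b - t) powr \<gamma> = \<kappa>"
      using t by (simp add: powr_minus)
    finally show "\<kappa> \<le> F t * (b - t) powr \<gamma>" .
  qed
  then have "\<kappa> \<le> F b * 0" by (intro tendsto_lowerbound[OF lim]) auto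
  with \<kappa> show False by simp
qed

text \<open>
  The integrating factor \<open>m t = exp (- (\<mu> / (\<beta> - 1)) * (1 + t) powr (1 - \<beta>))\<close> stays between
  \<open>exp (- \<mu> / (\<beta> - 1))\<close> and \<open>1\<close>, because \<open>\<beta> > 1\<close>.
\<close>

lemma damped_lower_bound:
  fixes y P :: "real \<Rightarrow> real"
  assumes \<mu>: "\<mu> > 0" and \<beta>: "\<beta> > 1" and T: "T \<ge> 0"
    and conty: "continuous_on {0..T} y" and contP: "continuous_on {0..T} P"
    and P0: "\<And>t. t \<in> {0..T} \<Longrightarrow> P t \<ge> 0" and y0: "y 0 \<ge> 0"
    and eq: "\<And>t. t \<in> {0..T} \<Longrightarrow>
      y t - y 0 + integral {0..t} (\<lambda>s. \<mu> * y s / (1 + s) powr \<beta>) = integral {0..t} P"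
  shows "y T \<ge> exp (- \<mu> / (\<beta> - 1)) * (y 0 + integral {0..T} P)"
proof -
  define m where "m t = exp (- (\<mu> / (\<beta> - 1)) * (1 + t) powr (1 - \<beta>))" for t
  define D where "D s = \<mu> * y s / (1 + s) powr \<beta>" for s
  let ?m0 = "exp (- \<mu> / (\<beta> - 1))"
  have dm: "(m has_real_derivative m t * (\<mu> / (1 + t) powr \<beta>)) (at t within {0..T})" if "t \<ge> 0" for t
  proof -
    have "(m has_real_derivative m t * (- (\<mu> / (\<beta> - 1)) * ((1 - \<beta>) * (1 + t) powr (1 - \<beta> - 1)))) (at t)"
      using that \<beta> unfolding m_def by (auto intro!: derivative_eq_intros)
    also have "- (\<mu> / (\<beta> - 1)) * ((1 - \<beta>) * (1 + t) powr (1 - \<beta> - 1)) = \<mu> / (1 + t) powr \<beta>"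
    proof -
      have "- (\<mu> / (\<beta> - 1)) * ((1 - \<beta>) * (1 + t) powr (1 - \<beta> - 1))
          = \<mu> / (\<beta> - 1) * (\<beta> - 1) * (1 + t) powr (- \<beta>)"
        by (simp add: algebra_simps diff_divide_distrib)
      also have "\<mu> / (\<beta> - 1) * (\<beta> - 1) = \<mu>" using \<beta> by simp
      finally show ?thesis by (simp add: powr_minus divide_inverse)
    qed
    finally show ?thesis by (rule has_field_derivative_at_within)
  qed
  have m_ge: "?m0 \<le> m t" and m_le: "m t \<le> 1" if "t \<ge> 0" for t
  proof -
    have "(1 + t) powr (1 - \<beta>) \<le> 1" using that \<beta> powr_mono[of "1 - \<beta>" 0 "1 + t"] by simp
    then show "?m0 \<le> m t"
      using \<mu> \<beta> by (simp add: m_def divide_right_mono)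
    show "m t \<le> 1" using \<mu> \<beta> by (simp add: m_def)
  qed
  have contD: "continuous_on {0..T} D" unfolding D_def
    by (intro continuous_intros conty) auto
  \<comment> \<open>The bracket is \<open>y t\<close>, written through the integral equation so that
    it can be differentiated. The damping cancels against the derivative of \<open>m\<close>,
    leaving \<open>(m t - ?m0) * P t\<close>, which is nonnegative.\<close>
  define w where "w t = m t * (y 0 - integral {0..t} D + integral {0..t} P) - ?m0 * integral {0..t} P" for t
  have yw: "y t = y 0 - integral {0..t} D + integral {0..t} P" if "t \<in> {0..T}" for t
    using eq[OF that] unfolding D_def[abs_def] by simp
  have dw: "(w has_real_derivative (m t - ?m0) * P t) (at t within {0..T})" if t: "t \<in> {0..T}" for t
  proof -
    have "(w has_real_derivative
        m t * (\<mu> / (1 + t) powr \<beta>) * (y 0 - integral {0..t} D + integral {0..t} P)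
        + (0 - D t + P t) * m t - ?m0 * P t) (at t within {0..T})"
      unfolding w_def using t
      by (intro DERIV_diff DERIV_mult DERIV_add DERIV_const DERIV_cmult dm
          integral_has_real_derivative contD contP) auto
    also have "m t * (\<mu> / (1 + t) powr \<beta>) * (y 0 - integral {0..t} D + integral {0..t} P)
        + (0 - D t + P t) * m t - ?m0 * P t = (m t - ?m0) * P t"
      unfolding yw[OF t, symmetric] by (simp add: D_def algebra_simps)
    finally show ?thesis .
  qed
  have "w 0 \<le> w T"
  proof (rule DERIV_nonneg_imp_increasing_open[OF T])
    fix t assume t: "0 < t" "t < T"
    then have "(w has_real_derivative (m t - ?m0) * P t) (at t)"
      using dw[of t] by (simp add: at_within_Icc_at)
    then show "\<exists>d. (w has_real_derivative d) (at t) \<and> d \<ge> 0"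
      using m_ge[of t] P0[of t] t by (intro exI[of _ "(m t - ?m0) * P t"] conjI) auto
  next
    show "continuous_on {0..T} w" by (rule DERIV_continuous_on[where D="\<lambda>t. (m t - ?m0) * P t"]) (rule dw)
  qed
  moreover have "w T = m T * y T - ?m0 * integral {0..T} P"
    using yw[of T] T by (simp add: w_def)
  moreover have "w 0 = m 0 * y 0" by (simp add: w_def)
  ultimately have le: "?m0 * integral {0..T} P + m 0 * y 0 \<le> m T * y T" by simp
  moreover have "?m0 * y 0 \<le> m 0 * y 0" using m_ge[of 0] y0 by (intro mult_right_mono) auto
  ultimately have le: "?m0 * (y 0 + integral {0..T} P) \<le> m T * y T" by (simp add: distrib_left)
  \<comment> \<open>Replacing \<open>m T\<close> by its upper bound \<open>1\<close> requires
    \<open>y T\<close> to be nonnegative, which follows from the estimate itself.\<close>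
  have "integral {0..T} P \<ge> 0" using P0 by (intro integral_nonneg integrable_continuous_real contP)
  then have "0 \<le> ?m0 * (y 0 + integral {0..T} P)" using y0 by simp
  with le have "0 \<le> m T * y T" by simp
  then have "0 \<le> y T" by (simp add: m_def zero_le_mult_iff)
  then have "m T * y T \<le> y T" using m_le[OF T] by (simp add: mult_left_le_one_le m_def)
  with le show ?thesis by simp
qed

text \<open>If the bound failed, \<open>F\<close> would lie above an explicit solution exploding at
  \<open>2 * S\<close>, a time before \<open>T\<close>. Linear growth up to time \<open>S\<close>
  supplies the initial value for the comparison, and \<open>A\<close> its initial slope.\<close>

lemma lifespan_estimate:
  fixes F y Q :: "real \<Rightarrow> real"
  assumes p: "1 < p" "p < 2" and \<gamma>: "\<gamma> = 2 / (p - 1)" and c: "c > 0" and R: "R > 0" and A: "A > 0"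
    and F0: "F 0 \<ge> 0"
    and F': "\<And>t. t \<in> {0..<T} \<Longrightarrow> (F has_real_derivative y t) (at t within {0..<T})"
    and y: "\<And>t. t \<in> {0..<T} \<Longrightarrow> y t \<ge> A + c * integral {0..t} Q"
    and contQ: "continuous_on {0..<T} Q" and Q0: "\<And>t. t \<in> {0..<T} \<Longrightarrow> Q t \<ge> 0"
    and Q: "\<And>t. t \<in> {0..<T} \<Longrightarrow> F t \<ge> 0 \<Longrightarrow> Q t \<ge> (t + R)\<^sup>2 powr (1 - p) * F t powr p"
    and S: "R \<le> S" "2 * S < T"
  shows "A \<le> \<gamma> * 9 * (\<gamma> * (\<gamma> + 1) / c) powr (1 / (p - 1)) * S powr (1 - \<gamma>)"
proof (rule ccontr)
  define \<kappa>0 where "\<kappa>0 = 9 * (\<gamma> * (\<gamma> + 1) / c) powr (1 / (p - 1))"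
  assume "\<not> ?thesis"
  then have big: "A > \<gamma> * \<kappa>0 * S powr (1 - \<gamma>)" by (simp add: \<kappa>0_def mult.assoc)
  have S0: "S > 0" using S R by simp
  have \<gamma>1: "\<gamma> \<ge> 1" using p by (simp add: \<gamma> field_simps)
  have \<kappa>0: "\<kappa>0 > 0" using \<gamma>1 c by (simp add: \<kappa>0_def)
  have intQ: "Q integrable_on {s..t}" if "0 \<le> s" "t < T" for s t
    using that by (intro integrable_continuous_real continuous_on_subset[OF contQ]) auto
  have yA: "y t \<ge> A" if t: "t \<in> {0..<T}" for t
  proof -
    have "integral {0..t} Q \<ge> 0" using t by (intro integral_nonneg intQ Q0) auto
    with y[OF t] c show ?thesis by (smt (verit) mult_nonneg_nonneg)
  qed
  have growth: "F t \<ge> A * t" if t: "t \<in> {0..<T}" for t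
  proof -
    have "F 0 - A * 0 \<le> F t - A * t"
    proof (rule DERIV_nonneg_imp_increasing_open[where f="\<lambda>s. F s - A * s"])
      fix s assume s: "0 < s" "s < t"
      then have "(F has_real_derivative y s) (at s within {0<..<T})"
        using F'[of s] t by (auto elim: DERIV_subset)
      moreover have "at s within {0<..<T} = at s" using s t by (intro at_within_open) auto
      ultimately have "((\<lambda>s. F s - A * s) has_real_derivative y s - A * 1) (at s)"
        by (intro DERIV_diff DERIV_cmult DERIV_ident) simp
      with yA[of s] s t show "\<exists>d. ((\<lambda>s. F s - A * s) has_real_derivative d) (at s) \<and> d \<ge> 0"
        by (intro exI[of _ "y s - A * 1"] conjI) auto
    next
      have "continuous_on {0..<T} F" by (rule DERIV_continuous_on[where D=y]) (rule F')
      then show "continuous_on {0..t} (\<lambda>s. F s - A * s)"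
        using t by (intro continuous_intros) (auto intro: continuous_on_subset)
    qed (use t in auto)
    with F0 show ?thesis by simp
  qed
  have Fnn: "F t \<ge> 0" if "t \<in> {0..<T}" for t
  proof -
    have "A * t \<ge> 0" using that A by simp
    with growth[OF that] show ?thesis by linarith
  qed
  \<comment> \<open>On \<open>[S, 2 S]\<close> one has \<open>s + R \<le> 3 * S\<close>, whence the
    factor \<open>9\<close>. Given the resulting \<open>K\<close>, the equation
    \<open>K * \<kappa> powr (p - 1) = \<gamma> * (\<gamma> + 1)\<close> determines
    \<open>\<kappa>\<close>, and its dependence on \<open>S\<close> is quadratic.\<close>
  define \<kappa> where "\<kappa> = \<kappa>0 * S\<^sup>2"
  define K where "K = c * (9 * S\<^sup>2) powr (1 - p)"
  have sq: "S\<^sup>2 = S powr 2" using S0 by (simp add: powr_numeral)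
  show False
  proof (rule blowup_comparison[of S "2 * S" p \<gamma> \<kappa> K F y A])
    show "\<kappa> > 0" using \<kappa>0 S0 by (simp add: \<kappa>_def)
    have "\<kappa> = 9 * S\<^sup>2 * (\<gamma> * (\<gamma> + 1) / c) powr (1 / (p - 1))" by (simp add: \<kappa>_def \<kappa>0_def)
    then have "\<kappa> powr (p - 1) = (9 * S\<^sup>2) powr (p - 1) * (\<gamma> * (\<gamma> + 1) / c)"
      using p c \<gamma>1 S0 by (simp add: powr_mult powr_powr)
    moreover have "(9 * S\<^sup>2) powr (1 - p) * (9 * S\<^sup>2) powr (p - 1) = 1"
      using S0 by (simp flip: powr_add)
    ultimately show "K * \<kappa> powr (p - 1) = \<gamma> * (\<gamma> + 1)"
      using c by (simp add: K_def)
    show "(F has_real_derivative y t) (at t within {S..2 * S})" if "t \<in> {S..2 * S}" for t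
      using F'[of t] that S S0 by (auto elim!: DERIV_subset)
    show "A + K * integral {S..t} (\<lambda>s. F s powr p) \<le> y t" if t: "t \<in> {S..2 * S}" for t
    proof -
      have "integral {S..t} (\<lambda>s. (9 * S\<^sup>2) powr (1 - p) * F s powr p) \<le> integral {S..t} Q"
      proof (rule integral_le)
        have "continuous_on {0..<T} F" by (rule DERIV_continuous_on[where D=y]) (rule F')
        then have "continuous_on {S..t} F" using t S S0 by (auto intro: continuous_on_subset)
        then have "continuous_on {S..t} (\<lambda>s. F s powr p)"
          by (rule continuous_on_powr') (use Fnn p t S S0 in auto)
        then show "(\<lambda>s. (9 * S\<^sup>2) powr (1 - p) * F s powr p) integrable_on {S..t}"
          by (intro integrable_continuous_real continuous_on_mult_left)
        show "Q integrable_on {S..t}" using t S S0 by (intro intQ) auto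
        fix s assume s: "s \<in> {S..t}"
        then have s': "s \<in> {0..<T}" using t S S0 by auto
        have "(s + R)\<^sup>2 \<le> (3 * S)\<^sup>2" using s t S S0 R by (intro power_mono) auto
        then have "(9 * S\<^sup>2) powr (1 - p) \<le> (s + R)\<^sup>2 powr (1 - p)"
          using p s' R by (intro powr_mono2') (auto simp: power_mult_distrib)
        then have "(9 * S\<^sup>2) powr (1 - p) * F s powr p \<le> (s + R)\<^sup>2 powr (1 - p) * F s powr p"
          by (intro mult_right_mono) auto
        with Q[OF s' Fnn[OF s']] show "(9 * S\<^sup>2) powr (1 - p) * F s powr p \<le> Q s" by linarith
      qed
      also have "integral {S..t} Q \<le> integral {0..t} Q"
        using t S S0 by (intro integral_subset_le intQ) (auto intro!: Q0)
      finally have "K * integral {S..t} (\<lambda>s. F s powr p) \<le> c * integral {0..t} Q"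
        using c by (simp add: K_def mult.assoc)
      with y[of t] t S S0 show ?thesis by simp
    qed
    have eq: "S * (\<kappa>0 * S powr (1 - \<gamma>)) = \<kappa> * S powr - \<gamma>"
      using S0 by (simp add: \<kappa>_def powr_diff powr_minus sq field_simps power2_eq_square)
    \<comment> \<open>Because \<open>\<gamma> \<ge> 1\<close>, the condition on the initial slope
      also yields the one on the initial value, through \<open>F S \<ge> A * S\<close>.\<close>
    have "\<kappa>0 * S powr (1 - \<gamma>) \<le> \<gamma> * \<kappa>0 * S powr (1 - \<gamma>)"
      using \<gamma>1 \<kappa>0 by (intro mult_right_mono) auto
    with big have "\<kappa>0 * S powr (1 - \<gamma>) < A" by linarith
    then have "S * (\<kappa>0 * S powr (1 - \<gamma>)) < A * S" using S0 by simp
    also have "\<dots> \<le> F S" using growth[of S] S S0 by simp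
    finally show "\<kappa> * (2 * S - S) powr - \<gamma> < F S" by (simp add: eq)
    have "S powr (1 - \<gamma>) = S\<^sup>2 * S powr (- \<gamma> - 1)"
      using powr_add[of S 2 "- \<gamma> - 1"] unfolding sq by simp
    with big show "\<kappa> * \<gamma> * (2 * S - S) powr (- \<gamma> - 1) \<le> A"
      by (simp add: \<kappa>_def mult_ac)
  qed (use S0 p \<gamma> in auto)
qed

section \<open>The averaged equation\<close>

text \<open>A negative value would persist on an interval to the right of \<open>t\<close>, which
  has positive measure. The right side is taken because \<open>t\<close> may be
  \<open>0\<close>.\<close>

lemma AE_nonneg_continuous_imp_nonneg:
  fixes h :: "real \<Rightarrow> real"
  assumes cont: "continuous_on {0..<T} h" and ae: "AE s in lebesgue. s \<in> {0..<T} \<longrightarrow> h s \<ge> 0"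
    and t: "t \<in> {0..<T}"
  shows "h t \<ge> 0"
proof (rule ccontr)
  assume "\<not> h t \<ge> 0"
  then have neg: "h t < 0" by simp
  have "(h \<longlongrightarrow> h t) (at t within {0..<T})" using cont t by (simp add: continuous_on_def)
  then have "\<forall>\<^sub>F s in at t within {0..<T}. h s < 0" using neg by (rule order_tendstoD)
  then obtain d where d: "d > 0" "\<And>s. s \<in> {0..<T} \<Longrightarrow> s \<noteq> t \<Longrightarrow> dist s t < d \<Longrightarrow> h s < 0"
    by (auto simp: eventually_at)
  define e where "e = min (t + d) T"
  have "{t<..<e} \<subseteq> {s. \<not> (s \<in> {0..<T} \<longrightarrow> h s \<ge> 0)}"
    using d t by (auto simp: e_def dist_real_def not_le)
  moreover have "{s. \<not> (s \<in> {0..<T} \<longrightarrow> h s \<ge> 0)} \<in> null_sets lebesgue"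
    using ae by (simp add: eventually_ae_filter_negligible negligible_iff_null_sets[symmetric])
      (blast intro: negligible_subset)
  ultimately have "negligible {t<..<e}"
    by (auto simp: negligible_iff_null_sets intro: null_sets_completion_subset)
  moreover have "t < e" using d t by (simp add: e_def)
  ultimately show False using negligible_interval(2)[of t e] by simp
qed

lemma set_lebesgue_integral_eq_integral_continuous:
  fixes h :: "real \<Rightarrow> real"
  assumes "continuous_on {a..b} h"
  shows "(LINT s:{a..b}|lebesgue. h s) = integral {a..b} h"
  by (rule set_lebesgue_integral_eq_integral(2)[OF absolutely_integrable_continuous_real[OF assms]])

text \<open>With a test function constant in time on \<open>[0,t]\<close> the term with its time
  derivative drops out, and the gradient term vanishes by the support condition. The remaining
  integrands are continuous in time, so the Lebesgue integrals become ones to which the fundamental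
  theorem of calculus applies.\<close>

lemma energy_solution_averaged:
  fixes u :: "'a::euclidean_space \<times> real \<Rightarrow> real"
  assumes p: "1 < p" "p < 2"
    and u: "C0_in_time T H1_seminorm H1_space u" and C1: "C1_L2_in_time T u ut"
    and eq: "\<forall>\<phi>\<in>Cc_infinity (UNIV \<times> {..<T}). \<forall>t\<in>{0..<T}.
          (LINT x|lebesgue. ut (x, t) * \<phi> (x, t)) - (LINT x|lebesgue. ut (x, 0) * \<phi> (x, 0))
          + (LINT s:{0..t}|lebesgue. (LINT x|lebesgue.
               - ut (x, s) * time_derivative \<phi> (x, s)
               + weak_gradient (\<lambda>y. u (y, s)) x \<bullet> space_gradient \<phi> (x, s)))
          + (LINT s:{0..t}|lebesgue. (LINT x|lebesgue.
               \<mu> * ut (x, s) / (1 + s) powr \<beta> * \<phi> (x, s)))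
          = (LINT s:{0..t}|lebesgue. (LINT x|lebesgue. \<bar>u (x, s)\<bar> powr p * \<phi> (x, s)))"
    and off: "AE s in lebesgue. s \<in> {0..<T} \<longrightarrow> (AE x in lebesgue. x \<notin> ball 0 \<rho> \<longrightarrow> u (x, s) = 0)"
    and \<zeta>: "\<zeta> \<in> Cc_infinity UNIV" "smooth (\<lambda>z::'a \<times> real. \<zeta> (fst z))" "\<And>x. 0 \<le> \<zeta> x" "\<And>x. \<zeta> x \<le> 1"
      "\<And>x. norm x \<le> \<rho> \<Longrightarrow> \<zeta> x = 1"
    and y_def: "\<And>t. y t = (LINT x|lebesgue. ut (x, t) * \<zeta> x)"
    and P_def: "\<And>t. P t = (LINT x|lebesgue. \<bar>u (x, t)\<bar> powr p * \<zeta> x)"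
    and t: "t \<in> {0..<T}"
  shows "y t - y 0 + integral {0..t} (\<lambda>s. \<mu> * y s / (1 + s) powr \<beta>) = integral {0..t} P"
proof -
  have t': "0 \<le> t" "t < T" using t by auto
  obtain \<phi> where \<phi>: "\<phi> \<in> Cc_infinity (UNIV \<times> {..<T})"
    "\<And>x s. s \<in> {0..t} \<Longrightarrow> \<phi> (x, s) = \<zeta> x"
    "\<And>x s. s \<in> {0..t} \<Longrightarrow> time_derivative \<phi> (x, s) = 0"
    "\<And>x s. s \<in> {0..t} \<Longrightarrow> space_gradient \<phi> (x, s) = (\<Sum>b\<in>Basis. frechet_derivative \<zeta> (at x) b *\<^sub>R b)"
    using ex_test_function[OF t' \<zeta>(1,2)] by blast
  have \<zeta>L2: "\<zeta> \<in> L2_space" using \<zeta>(1) by (rule Cc_infinity_L2)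
  have C0: "C0_in_time T L2_seminorm L2_space u" "C0_in_time T L2_seminorm L2_space ut"
    using C1 by (auto simp: C1_L2_in_time_def)
  have sub: "{0..t} \<subseteq> {0..<T}" using t by auto
  have conty: "continuous_on {0..t} y"
    unfolding y_def[abs_def] by (rule continuous_on_subset[OF continuous_on_L2_pairing[OF C0(2) \<zeta>L2] sub])
  have contP: "continuous_on {0..t} P"
    unfolding P_def[abs_def]
    by (rule continuous_on_subset[OF continuous_on_powr_weight[OF p C0(1) \<zeta>L2 \<zeta>(3,4)] sub])
  \<comment> \<open>The support condition is known for almost every slice only, which is enough
    under the time integral.\<close>
  have grad: "(LINT s:{0..t}|lebesgue. (LINT x|lebesgue. - ut (x, s) * time_derivative \<phi> (x, s)
               + weak_gradient (\<lambda>y. u (y, s)) x \<bullet> space_gradient \<phi> (x, s))) = 0"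
    unfolding set_lebesgue_integral_def
  proof (rule integral_eq_zero_AE)
    show "AE s in lebesgue. indicat_real {0..t} s *\<^sub>R
      (LINT x|lebesgue. - ut (x, s) * time_derivative \<phi> (x, s)
               + weak_gradient (\<lambda>y. u (y, s)) x \<bullet> space_gradient \<phi> (x, s)) = 0"
      using off
    proof eventually_elim
      case (elim s)
      show ?case
      proof (cases "s \<in> {0..t}")
        case True
        then have s: "s \<in> {0..<T}" using sub by blast
        have "(\<lambda>x. u (x, s)) \<in> H1_space" using u s by (simp add: C0_in_time_def)
        then have "(LINT x|lebesgue. weak_gradient (\<lambda>y. u (y, s)) x \<bullet>
            (\<Sum>b\<in>Basis. frechet_derivative \<zeta> (at x) b *\<^sub>R b)) = 0"
          by (rule weak_gradient_cutoff_integral[OF _ \<zeta>(1) open_ball[of 0 \<rho>]])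
            (use \<zeta>(5) elim s in auto)
        then show ?thesis by (simp add: \<phi>(3,4)[OF True])
      qed simp
    qed
  qed
  have damp: "(LINT s:{0..t}|lebesgue. (LINT x|lebesgue. \<mu> * ut (x, s) / (1 + s) powr \<beta> * \<phi> (x, s)))
      = integral {0..t} (\<lambda>s. \<mu> * y s / (1 + s) powr \<beta>)"
  proof -
    have "(LINT s:{0..t}|lebesgue. (LINT x|lebesgue. \<mu> * ut (x, s) / (1 + s) powr \<beta> * \<phi> (x, s)))
        = (LINT s:{0..t}|lebesgue. \<mu> * y s / (1 + s) powr \<beta>)"
    proof (rule set_lebesgue_integral_cong; (intro allI impI)?)
      fix s assume s: "s \<in> {0..t}"
      have "(LINT x|lebesgue. \<mu> * ut (x, s) / (1 + s) powr \<beta> * \<phi> (x, s))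
          = (LINT x|lebesgue. (\<mu> / (1 + s) powr \<beta>) * (ut (x, s) * \<zeta> x))"
        by (intro Bochner_Integration.integral_cong) (simp_all add: \<phi>(2)[OF s])
      also have "\<dots> = (\<mu> / (1 + s) powr \<beta>) * y s"
        by (simp only: integral_mult_right_zero y_def)
      finally show "(LINT x|lebesgue. \<mu> * ut (x, s) / (1 + s) powr \<beta> * \<phi> (x, s)) = \<mu> * y s / (1 + s) powr \<beta>"
        by simp
    qed simp
    also have "\<dots> = integral {0..t} (\<lambda>s. \<mu> * y s / (1 + s) powr \<beta>)"
      by (intro set_lebesgue_integral_eq_integral_continuous continuous_intros conty) auto
    finally show ?thesis .
  qed
  have rhs: "(LINT s:{0..t}|lebesgue. (LINT x|lebesgue. \<bar>u (x, s)\<bar> powr p * \<phi> (x, s))) = integral {0..t} P"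
  proof -
    have "(LINT s:{0..t}|lebesgue. (LINT x|lebesgue. \<bar>u (x, s)\<bar> powr p * \<phi> (x, s)))
        = (LINT s:{0..t}|lebesgue. P s)"
      by (rule set_lebesgue_integral_cong; (intro allI impI)?) (simp_all add: \<phi>(2) P_def)
    also have "\<dots> = integral {0..t} P"
      by (intro set_lebesgue_integral_eq_integral_continuous contP)
    finally show ?thesis .
  qed
  have "0 \<in> {0..t}" "t \<in> {0..t}" using t by auto
  then have "(LINT x|lebesgue. ut (x, t) * \<phi> (x, t)) = y t" "(LINT x|lebesgue. ut (x, 0) * \<phi> (x, 0)) = y 0"
    by (simp_all add: \<phi>(2) y_def)
  then show ?thesis
    using bspec[OF bspec[OF eq \<phi>(1)] t] unfolding grad damp rhs by simp
qed

text \<open>Finite propagation speed bounds the measure in Hoelder's inequality by a multiple of \<open>(t + R)\<^sup>2\<close>.\<close>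

lemma powr_average_lower_bound:
  fixes u :: "(real ^ 2) \<times> real \<Rightarrow> real"
  assumes p: "1 < p" "p < 2" and C0: "C0_in_time T L2_seminorm L2_space u"
    and \<zeta>: "\<zeta> \<in> L2_space" "\<And>x. 0 \<le> \<zeta> x" "\<And>x. \<zeta> x \<le> 1" "\<And>x. norm x \<le> T + R \<Longrightarrow> \<zeta> x = 1"
    and off: "AE s in lebesgue. s \<in> {0..<T} \<longrightarrow> (AE x in lebesgue. norm x > s + R \<longrightarrow> u (x, s) = 0)"
    and R: "R > 0" and t: "t \<in> {0..<T}"
    and nonneg: "(LINT x|lebesgue. u (x, t) * \<zeta> x) \<ge> 0"
  shows "(unit_ball_vol 2 * (t + R)\<^sup>2) powr (1 - p) * (LINT x|lebesgue. u (x, t) * \<zeta> x) powr p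
      \<le> (LINT x|lebesgue. \<bar>u (x, t)\<bar> powr p * \<zeta> x)"
proof -
  \<comment> \<open>The average is assumed nonnegative at the given \<open>t\<close> only.
    Truncation keeps the base of the power nonnegative at all times, so \<open>?h\<close> is
    continuous, and where the average is negative the inequality is trivial.\<close>
  let ?F = "\<lambda>t. max 0 (LINT x|lebesgue. u (x, t) * \<zeta> x)"
  let ?P = "\<lambda>t. LINT x|lebesgue. \<bar>u (x, t)\<bar> powr p * \<zeta> x"
  let ?h = "\<lambda>t. ?P t - (unit_ball_vol 2 * (t + R)\<^sup>2) powr (1 - p) * ?F t powr p"
  have pi: "unit_ball_vol 2 > (0::real)" by simp
  then have pi': "unit_ball_vol 2 \<noteq> (0::real)" by (rule less_imp_neq[symmetric])
  have "?h t \<ge> 0"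
  proof (rule AE_nonneg_continuous_imp_nonneg[OF _ _ t])
    have "continuous_on {0..<T} (\<lambda>t. ?F t powr p)"
      by (rule continuous_on_powr') (use p in \<open>auto intro!: continuous_intros continuous_on_L2_pairing C0 \<zeta>\<close>)
    moreover have "continuous_on {0..<T} (\<lambda>t. (unit_ball_vol 2 * (t + R)\<^sup>2) powr (1 - p))"
      using R by (intro continuous_intros) (auto simp: pi')
    ultimately show "continuous_on {0..<T} ?h"
      by (intro continuous_on_diff continuous_on_mult continuous_on_powr_weight p C0 \<zeta>)
    show "AE s in lebesgue. s \<in> {0..<T} \<longrightarrow> 0 \<le> ?h s"
      using off
    proof eventually_elim
      case (elim s)
      show ?case
      proof
        assume s: "s \<in> {0..<T}"
        have v: "(\<lambda>x. u (x, s)) \<in> L2_space" using C0 s by (rule C0_in_time_L2_slice)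
        have int: "integrable lebesgue (\<lambda>x. \<bar>u (x, s)\<bar> powr p * \<zeta> x)"
          by (intro integrable_powr_weight p v \<zeta>)
        have "?P s \<ge> 0" using \<zeta> by (intro integral_nonneg_AE) auto
        moreover have "(unit_ball_vol 2 * (s + R)\<^sup>2) powr (1 - p) * (LINT x|lebesgue. u (x, s) * \<zeta> x) powr p \<le> ?P s"
          if "(LINT x|lebesgue. u (x, s) * \<zeta> x) \<ge> 0"
        proof (rule integral_powr_ge[OF p(1) v \<zeta>(1,2) int, where B="cball 0 (s + R)"])
          show "measure lebesgue (cball (0::real^2) (s + R)) \<le> unit_ball_vol 2 * (s + R)\<^sup>2"
            using s R by (simp add: content_cball)
          show "emeasure lebesgue (cball (0::real^2) (s + R)) < \<infinity>"
            using emeasure_lborel_cball_finite[of "0::real^2" "s + R"] by simp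
        qed (use s R \<zeta> elim that pi in \<open>auto simp: not_le\<close>)
        ultimately show "0 \<le> ?h s"
          using p by (cases "(LINT x|lebesgue. u (x, s) * \<zeta> x) \<ge> 0") (auto simp: max_def)
      qed
    qed
  qed
  with nonneg show ?thesis by simp
qed

section \<open>The initial velocity and the final lifespan bound\<close>

text \<open>A square-integrable \<open>g\<close> may have infinite integral, in which case its
  \<open>LINT\<close> would be \<open>0\<close> by convention. On a ball the integral is finite, and
  some ball already carries positive mass.\<close>

lemma ex_ball_integral_pos:
  fixes g :: "'a::euclidean_space \<Rightarrow> real"
  assumes g: "g \<in> L2_space" "AE x in lebesgue. g x \<ge> 0" and nz: "(\<integral>\<^sup>+ x. ennreal (g x) \<partial>lebesgue) \<noteq> 0"
  obtains r where "r > 0" "(LINT x|lebesgue. g x * indicator (cball 0 r) x) > 0"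
proof -
  have [measurable]: "g \<in> borel_measurable lebesgue" using g(1) by (rule L2_measurable)
  have "\<exists>n::nat. \<not> (AE x in lebesgue. g x * indicator (cball 0 (real n)) x = 0)"
  proof (rule ccontr)
    assume "\<not> ?thesis"
    then have "AE x in lebesgue. \<forall>n::nat. g x * indicator (cball 0 (real n)) x = 0"
      by (subst AE_all_countable) blast
    then have "AE x in lebesgue. ennreal (g x) = 0"
    proof eventually_elim
      case (elim x)
      obtain n :: nat where "norm x \<le> real n" using real_arch_simple by blast
      with elim[rule_format, of n] show ?case by simp
    qed
    then have "(\<integral>\<^sup>+ x. ennreal (g x) \<partial>lebesgue) = 0"
      by (subst nn_integral_0_iff_AE) auto
    with nz show False by simp
  qed
  then obtain n :: nat where n: "\<not> (AE x in lebesgue. g x * indicator (cball 0 (real n)) x = 0)" by blast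
  \<comment> \<open>Enlarging the radius by \<open>1\<close> makes it positive even for
    \<open>n = 0\<close>.\<close>
  have ind: "(\<lambda>x::'a. indicator (cball 0 (real n + 1)) x :: real) \<in> L2_space"
  proof -
    have int: "integrable lebesgue (\<lambda>x::'a. indicator (cball 0 (real n + 1)) x :: real)"
      using emeasure_lborel_cball_finite[of "0::'a" "real n + 1"] by (simp add: integrable_indicator_iff)
    have eq: "(\<lambda>x::'a. (norm (indicator (cball 0 (real n + 1)) x :: real))\<^sup>2)
        = indicator (cball 0 (real n + 1))"
      by (auto simp: indicator_def)
    show ?thesis
      unfolding L2_space_def mem_Collect_eq eq
      by (intro conjI int borel_measurable_integrable[OF int])
  qed
  have int: "integrable lebesgue (\<lambda>x. g x * indicator (cball 0 (real n + 1)) x)"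
    using g(1) ind by (rule L2_mult_integrable)
  have nn: "AE x in lebesgue. 0 \<le> g x * indicator (cball 0 (real n + 1)) x"
    using g(2) by eventually_elim (simp add: indicator_def)
  have "(LINT x|lebesgue. g x * indicator (cball 0 (real n + 1)) x) \<noteq> 0"
  proof
    assume "(LINT x|lebesgue. g x * indicator (cball 0 (real n + 1)) x) = 0"
    then have "AE x in lebesgue. g x * indicator (cball 0 (real n + 1)) x = 0"
      using integral_nonneg_eq_0_iff_AE[OF int nn] by simp
    then have "AE x in lebesgue. g x * indicator (cball 0 (real n)) x = 0"
      by eventually_elim (auto simp: indicator_def split: if_splits)
    with n show False by simp
  qed
  moreover have "(LINT x|lebesgue. g x * indicator (cball 0 (real n + 1)) x) \<ge> 0"
    using nn by (rule integral_nonneg_AE)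
  ultimately show ?thesis by (intro that[of "real n + 1"]) auto
qed

theorem theorem2p2:
  fixes f g :: "real ^ 2 \<Rightarrow> real" and p \<mu> \<beta> R :: real
  assumes "\<mu> > 0" and "\<beta> > 1" and "R \<ge> 1" and "1 < p" and "p < 2"
    and "f \<in> H1_space" and "g \<in> L2_space"
    and "AE x in lebesgue. f x \<ge> 0" and "AE x in lebesgue. g x \<ge> 0"
    and "\<not> (AE x in lebesgue. f x = 0)"
    and "(\<integral>\<^sup>+ x. ennreal (g x) \<partial>lebesgue) \<noteq> 0"
  shows "\<exists>\<epsilon>0>0. \<exists>C>0. \<forall>\<epsilon>. 0 < \<epsilon> \<and> \<epsilon> \<le> \<epsilon>0 \<longrightarrow>
    (\<forall>T>0. \<forall>u :: (real ^ 2) \<times> real \<Rightarrow> real.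
       energy_solution p \<mu> \<beta> (\<lambda>x. \<epsilon> * f x) (\<lambda>x. \<epsilon> * g x) T u \<and>
       ess_support (UNIV \<times> {0..<T}) u \<subseteq> {(x, t). t \<in> {0..<T} \<and> norm x \<le> t + R}
       \<longrightarrow> T \<le> C * \<epsilon> powr (- (p - 1) / (3 - p)))"
proof -
  note p = \<open>1 < p\<close> \<open>p < 2\<close>
  obtain r where r: "r > 0" and g0: "(LINT x|lebesgue. g x * indicator (cball 0 r) x) > 0"
    using ex_ball_integral_pos[OF \<open>g \<in> L2_space\<close> \<open>AE x in lebesgue. g x \<ge> 0\<close>]
      \<open>(\<integral>\<^sup>+ x. ennreal (g x) \<partial>lebesgue) \<noteq> 0\<close> by blast
  define \<gamma> where "\<gamma> = 2 / (p - 1)"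
  define m0 where "m0 = exp (- \<mu> / (\<beta> - 1))"
  define a where "a = m0 * (LINT x|lebesgue. g x * indicator (cball 0 r) x)"
  define c where "c = m0 * unit_ball_vol 2 powr (1 - p)"
  define D where "D = \<gamma> * 9 * (\<gamma> * (\<gamma> + 1) / c) powr (1 / (p - 1))"
  \<comment> \<open>The exponent is \<open>1 / (\<gamma> - 1)\<close>, so that raising to the power
    \<open>- q\<close> solves \<open>a * \<epsilon> \<le> D * S powr (1 - \<gamma>)\<close> for
    \<open>S\<close>. In \<open>C\<close>, the summand \<open>2 * R\<close> pays for the requirement
    \<open>R \<le> S\<close>.\<close>
  define q where "q = (p - 1) / (3 - p)"
  define C where "C = 2 * R + 2 * (D / a) powr q"
  have "1 - \<gamma> = - ((3 - p) / (p - 1))" using p by (simp add: \<gamma>_def field_simps)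
  then have q: "q > 0" "(1 - \<gamma>) * - q = 1" using p by (simp_all add: q_def divide_eq_eq)
  have \<gamma>: "\<gamma> > 0" using p by (simp add: \<gamma>_def)
  have pos: "m0 > 0" "a > 0" using g0 by (simp_all add: m0_def a_def)
  have pi: "unit_ball_vol 2 > (0::real)" by simp
  then have pi': "unit_ball_vol 2 \<noteq> (0::real)" by (rule less_imp_neq[symmetric])
  have c: "c > 0" using pos pi' by (simp add: c_def)
  have D: "D > 0" using \<gamma> c by (simp add: D_def)
  have "C > 0" using \<open>R \<ge> 1\<close> by (simp add: C_def add_pos_nonneg)
  moreover have "T \<le> C * \<epsilon> powr (- (p - 1) / (3 - p))"
    if \<epsilon>: "0 < \<epsilon>" "\<epsilon> \<le> 1" and "T > 0"
      and sol: "energy_solution p \<mu> \<beta> (\<lambda>x. \<epsilon> * f x) (\<lambda>x. \<epsilon> * g x) T u"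
      and supp: "ess_support (UNIV \<times> {0..<T}) u \<subseteq> {(x, t). t \<in> {0..<T} \<and> norm x \<le> t + R}"
    for \<epsilon> T and u :: "(real ^ 2) \<times> real \<Rightarrow> real"
  proof (rule ccontr)
    assume "\<not> T \<le> C * \<epsilon> powr (- (p - 1) / (3 - p))"
    then have big: "C * \<epsilon> powr - q < T"
      unfolding q_def minus_divide_left by (rule not_le_imp_less)
    obtain ut where C1: "C1_L2_in_time T u ut"
      and init: "AE x in lebesgue. u (x, 0) = \<epsilon> * f x" "AE x in lebesgue. ut (x, 0) = \<epsilon> * g x"
      and eq: "\<forall>\<phi>\<in>Cc_infinity (UNIV \<times> {..<T}). \<forall>t\<in>{0..<T}.
          (LINT x|lebesgue. ut (x, t) * \<phi> (x, t)) - (LINT x|lebesgue. ut (x, 0) * \<phi> (x, 0))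
          + (LINT s:{0..t}|lebesgue. (LINT x|lebesgue.
               - ut (x, s) * time_derivative \<phi> (x, s)
               + weak_gradient (\<lambda>y. u (y, s)) x \<bullet> space_gradient \<phi> (x, s)))
          + (LINT s:{0..t}|lebesgue. (LINT x|lebesgue.
               \<mu> * ut (x, s) / (1 + s) powr \<beta> * \<phi> (x, s)))
          = (LINT s:{0..t}|lebesgue. (LINT x|lebesgue. \<bar>u (x, s)\<bar> powr p * \<phi> (x, s)))"
      using sol unfolding energy_solution_def by (elim conjE exE) (rule that)
    have uH1: "C0_in_time T H1_seminorm H1_space u" using sol by (simp add: energy_solution_def)
    have C0: "C0_in_time T L2_seminorm L2_space u" "C0_in_time T L2_seminorm L2_space ut"
      using C1 by (auto simp: C1_L2_in_time_def)
    \<comment> \<open>The radius covers the support at all times before \<open>T\<close> as well as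
      the ball carrying the mass of \<open>g\<close>.\<close>
    define \<rho> where "\<rho> = T + R + r"
    have "\<rho> > 0" using \<open>T > 0\<close> \<open>R \<ge> 1\<close> r by (simp add: \<rho>_def)
    then obtain \<zeta> :: "real ^ 2 \<Rightarrow> real" where \<zeta>: "\<zeta> \<in> Cc_infinity UNIV"
      "smooth (\<lambda>z::(real ^ 2) \<times> real. \<zeta> (fst z))" "\<And>x. 0 \<le> \<zeta> x" "\<And>x. \<zeta> x \<le> 1"
      "\<And>x. norm x \<le> \<rho> \<Longrightarrow> \<zeta> x = 1"
      using ex_space_cutoff by metis
    have \<zeta>L2: "\<zeta> \<in> L2_space" using \<zeta>(1) by (rule Cc_infinity_L2)
    have "AE z in lebesgue. z \<in> UNIV \<times> {0..<T} \<longrightarrow> z \<notin> ess_support (UNIV \<times> {0..<T}) u \<longrightarrow> u z = 0"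
      by (rule AE_outside_ess_support)
    then have "AE z in lebesgue. snd z \<in> {0..<T} \<longrightarrow> norm (fst z) > snd z + R \<longrightarrow> u z = 0"
      by eventually_elim (use supp in force)
    from AE_lebesgue_time_slices[OF this]
    have off: "AE s in lebesgue. s \<in> {0..<T} \<longrightarrow> (AE x in lebesgue. norm x > s + R \<longrightarrow> u (x, s) = 0)"
      by eventually_elim (auto elim: eventually_mono)
    define y where "y t = (LINT x|lebesgue. ut (x, t) * \<zeta> x)" for t
    define P where "P t = (LINT x|lebesgue. \<bar>u (x, t)\<bar> powr p * \<zeta> x)" for t
    define F where "F t = (LINT x|lebesgue. u (x, t) * \<zeta> x)" for t
    have avg: "y t - y 0 + integral {0..t} (\<lambda>s. \<mu> * y s / (1 + s) powr \<beta>) = integral {0..t} P"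
      if "t \<in> {0..<T}" for t
    proof (rule energy_solution_averaged[OF p uH1 C1 eq _ \<zeta> y_def P_def that])
      show "AE s in lebesgue. s \<in> {0..<T} \<longrightarrow> (AE x in lebesgue. x \<notin> ball 0 \<rho> \<longrightarrow> u (x, s) = 0)"
        using off
      proof eventually_elim
        case (elim s)
        show ?case
        proof
          assume s: "s \<in> {0..<T}"
          with elim have "AE x in lebesgue. norm x > s + R \<longrightarrow> u (x, s) = 0" by blast
          then show "AE x in lebesgue. x \<notin> ball 0 \<rho> \<longrightarrow> u (x, s) = 0"
            by eventually_elim (use s r in \<open>auto simp: \<rho>_def\<close>)
        qed
      qed
    qed
    have y0: "y 0 \<ge> \<epsilon> * (LINT x|lebesgue. g x * indicator (cball 0 r) x)"
    proof -
      have "(LINT x|lebesgue. g x * indicator (cball 0 r) x) \<le> (LINT x|lebesgue. g x * \<zeta> x)"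
      proof (rule integral_mono_AE)
        show "integrable lebesgue (\<lambda>x. g x * indicator (cball 0 r) x)"
          \<comment> \<open>A function that is not integrable has integral \<open>0\<close> by
            convention, so the positive value in \<open>g0\<close> implies integrability.\<close>
          using g0 not_integrable_integral_eq by fastforce
        show "integrable lebesgue (\<lambda>x. g x * \<zeta> x)"
          using \<open>g \<in> L2_space\<close> \<zeta>L2 by (rule L2_mult_integrable)
        show "AE x in lebesgue. g x * indicator (cball 0 r) x \<le> g x * \<zeta> x"
          using \<open>AE x in lebesgue. g x \<ge> 0\<close>
          by eventually_elim
            (use \<zeta>(3,5) \<open>T > 0\<close> \<open>R \<ge> 1\<close> in \<open>auto simp: indicator_def \<rho>_def\<close>)
      qed
      moreover have "y 0 = \<epsilon> * (LINT x|lebesgue. g x * \<zeta> x)"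
      proof -
        have "y 0 = (LINT x|lebesgue. \<epsilon> * (g x * \<zeta> x))" unfolding y_def
        proof (rule integral_cong_AE)
          show "(\<lambda>x. ut (x, 0) * \<zeta> x) \<in> borel_measurable lebesgue"
            using C0_in_time_L2_slice[OF C0(2), of 0] \<zeta>L2 \<open>T > 0\<close>
            by (intro borel_measurable_times L2_measurable) auto
          show "(\<lambda>x. \<epsilon> * (g x * \<zeta> x)) \<in> borel_measurable lebesgue"
            using \<open>g \<in> L2_space\<close> \<zeta>L2
            by (intro borel_measurable_times L2_measurable borel_measurable_const)
          show "AE x in lebesgue. ut (x, 0) * \<zeta> x = \<epsilon> * (g x * \<zeta> x)"
            using init(2) by eventually_elim simp
        qed
        then show ?thesis by simp
      qed
      ultimately show ?thesis using \<epsilon> by simp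
    qed
    then have y0nn: "y 0 \<ge> 0" using \<epsilon> g0 by (smt (verit) mult_pos_pos)
    have F0: "F 0 \<ge> 0" unfolding F_def
    proof (rule integral_nonneg_AE)
      show "AE x in lebesgue. 0 \<le> u (x, 0) * \<zeta> x"
        using init(1) \<open>AE x in lebesgue. f x \<ge> 0\<close>
        by eventually_elim (use \<epsilon> \<zeta>(3) in simp)
    qed
    have contP: "continuous_on {0..<T} P"
      unfolding P_def[abs_def] by (rule continuous_on_powr_weight[OF p C0(1) \<zeta>L2 \<zeta>(3,4)])
    have conty: "continuous_on {0..<T} y"
      unfolding y_def[abs_def] by (rule continuous_on_L2_pairing[OF C0(2) \<zeta>L2])
    have P0: "P t \<ge> 0" for t unfolding P_def using \<zeta>(3) by (intro integral_nonneg_AE) auto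
    define \<omega> where "\<omega> = unit_ball_vol 2 powr (1 - p)"
    have \<omega>: "\<omega> > 0" using pi' by (simp add: \<omega>_def)
    define Q where "Q t = P t / \<omega>" for t
    have y_ge: "y t \<ge> a * \<epsilon> + c * integral {0..t} Q" if t: "t \<in> {0..<T}" for t
    proof -
      have sub: "{0..t} \<subseteq> {0..<T}" using t by auto
      have "y t \<ge> m0 * (y 0 + integral {0..t} P)"
        unfolding m0_def
      proof (rule damped_lower_bound[OF \<open>\<mu> > 0\<close> \<open>\<beta> > 1\<close>])
        show "continuous_on {0..t} y" "continuous_on {0..t} P"
          using conty contP sub by (auto intro: continuous_on_subset)
      qed (use t P0 y0nn avg sub in auto)
      moreover have "m0 * integral {0..t} P = c * integral {0..t} Q"
        using \<omega> by (simp add: c_def \<omega>_def[symmetric] Q_def[abs_def])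
      moreover have "m0 * y 0 \<ge> a * \<epsilon>"
        using mult_left_mono[OF y0, of m0] pos by (simp add: a_def mult_ac)
      ultimately show ?thesis by (simp add: distrib_left)
    qed
    \<comment> \<open>A quarter of the gap between \<open>T\<close> and the claimed bound is added:
      \<open>S\<close> strictly exceeds the threshold, while \<open>2 * S\<close> uses up only half
      of the gap and stays below \<open>T\<close>.\<close>
    define S where "S = max R ((D / a) powr q * \<epsilon> powr - q) + (T - C * \<epsilon> powr - q) / 4"
    \<comment> \<open>Here the choice \<open>\<epsilon>0 = 1\<close> enters: it allows
      \<open>R\<close> to be absorbed into \<open>R * \<epsilon> powr - q\<close>.\<close>
    have \<epsilon>q: "\<epsilon> powr - q \<ge> 1" using \<epsilon> q powr_mono'[of "- q" 0 \<epsilon>] by simp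
    have "2 * max R ((D / a) powr q * \<epsilon> powr - q) \<le> C * \<epsilon> powr - q"
    proof -
      have "R * 1 \<le> R * \<epsilon> powr - q" using \<epsilon>q \<open>R \<ge> 1\<close> by (intro mult_left_mono) auto
      moreover have "0 \<le> (D / a) powr q * \<epsilon> powr - q" by simp
      moreover have "C * \<epsilon> powr - q = 2 * (R * \<epsilon> powr - q) + 2 * ((D / a) powr q * \<epsilon> powr - q)"
        by (simp add: C_def algebra_simps)
      ultimately show ?thesis using \<open>R \<ge> 1\<close> by linarith
    qed
    then have S: "R \<le> S" "2 * S < T" "(D / a) powr q * \<epsilon> powr - q < S" "S > 0"
      using big \<open>R \<ge> 1\<close> by (auto simp: S_def field_simps max_def)
    have "a * \<epsilon> \<le> D * S powr (1 - \<gamma>)"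
      unfolding D_def
    proof (rule lifespan_estimate[where F=F and y=y and Q=Q and T=T and R=R])
      show "(F has_real_derivative y t) (at t within {0..<T})" if "t \<in> {0..<T}" for t
        unfolding F_def[abs_def] y_def by (rule has_derivative_L2_pairing[OF C1 \<zeta>L2 that])
      show "(t + R)\<^sup>2 powr (1 - p) * F t powr p \<le> Q t" if t: "t \<in> {0..<T}" and "F t \<ge> 0" for t
      proof -
        have "(unit_ball_vol 2 * (t + R)\<^sup>2) powr (1 - p) * F t powr p \<le> P t"
          unfolding F_def P_def
          by (rule powr_average_lower_bound[OF p C0(1) \<zeta>L2 \<zeta>(3,4) _ off _ t])
            (use \<zeta>(5) r \<open>R \<ge> 1\<close> that in \<open>auto simp: \<rho>_def F_def\<close>)
        also have "(unit_ball_vol 2 * (t + R)\<^sup>2) powr (1 - p) = \<omega> * (t + R)\<^sup>2 powr (1 - p)"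
          by (simp add: \<omega>_def powr_mult)
        finally show ?thesis using \<omega> by (simp add: Q_def pos_le_divide_eq mult_ac)
      qed
      show "continuous_on {0..<T} Q" unfolding Q_def[abs_def] using \<omega> by (intro continuous_intros contP) auto
      show "a * \<epsilon> + c * integral {0..t} Q \<le> y t" if "t \<in> {0..<T}" for t using that by (rule y_ge)
      show "Q t \<ge> 0" for t using P0 \<omega> by (simp add: Q_def)
    qed (use p \<gamma>_def c F0 S pos \<epsilon> \<open>R \<ge> 1\<close> in auto)
    then have "(D / a) powr q * \<epsilon> powr - q \<ge> S"
    proof -
      assume le: "a * \<epsilon> \<le> D * S powr (1 - \<gamma>)"
      have "S = (S powr (1 - \<gamma>)) powr - q" using S by (simp only: powr_powr q(2)) simp
      also have "\<dots> \<le> (a * \<epsilon> / D) powr - q"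
        using le D pos \<epsilon> q by (intro powr_mono2') (auto simp: pos_divide_le_eq mult.commute)
      also have "\<dots> = (D / a) powr q * \<epsilon> powr - q"
        using D pos \<epsilon> by (simp add: powr_mult powr_divide powr_minus field_simps)
      finally show ?thesis .
    qed
    with S(3) show False by simp
  qed
  ultimately show ?thesis by (intro exI[of _ 1] exI[of _ C]) auto
qed

end
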